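(* Let $B$ be a skew brace with property (S) and let $R=\operatorname{Rad}(B)$. Then $B/R$ can be embedded (as a skew brace) into the direct product $C\times D$, where (1) $C$ is the restricted direct product of all simple homomorphic images of $B$ which are not trivial braces, i.e. $C$ is the restricted direct product of the skew braces $B/I$, where $I$ ranges over all maximal ideals of $B$ such that $B/I$ is not a trivial brace, and (2) $D$ is a trivial brace which is an unrestricted direct product of trivial braces of prime order. Moreover, $B/A$ is isomorphic to $C$, where $A$ is the ideal of $B$ containing $R$ with $A/R=\operatorname{Ann}(B/R)$.
   Context: A skew (left) brace is a triple $(B,+,\circ)$ where $(B,+)$ and $(B,\circ)$ are (not necessarily abelian) groups such that $a\circ(b+c)=a\circ b-a+a\circ c$ for all $a,b,c\in B$. The two identities coincide and are denoted $0$. Put $\lambda_a(b)=-a+a\circ b$ and $a\ast b=\lambda_a(b)-b=-a+a\circ b-b$; $\lambda:(B,\circ)\to\operatorname{Aut}(B,+)$, $a\mapsto\lambda_a$, is a group homomorphism. A trivial brace is a skew brace in which $(B,+)$ is abelian and $a\circ b=a+b$ for all $a,b$. For $x\in B$ let $\operatorname{Fix}^r(x)=\{b\in B: x\ast b=0\}$ (a subgroup of $(B,+)$), $\operatorname{Fix}^l(x)=\{b\in B: b\ast x=0\}$ (a subgroup of $(B,\circ)$), and let $C_x^+$, $C_x^\circ$ be the centralisers of $x$ in $(B,+)$ and $(B,\circ)$. An element $x$ has property (s) if the indices $|(B,+):\operatorname{Fix}^r(x)\cap C_x^+|$ and $|(B,\circ):\operatorname{Fix}^l(x)\cap C_x^\circ|$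 are both finite. $B$ has property (S) if all its elements have property (s). An ideal of $B$ is a subset $I$ that is a normal subgroup of both $(B,+)$ and $(B,\circ)$ and satisfies $\lambda_a(I)\subseteq I$ for all $a\in B$; then $B/I$ is a skew brace. A skew brace is simple if it is non-zero and has no proper non-zero ideals. A maximal ideal is a proper ideal maximal among proper ideals. $\operatorname{Rad}(B)$ is the intersection of all maximal ideals of $B$ (equal to $B$ if there are none). The annihilator is the ideal $\operatorname{Ann}(B)=\operatorname{Ker}(\lambda)\cap Z(B,+)\cap Z(B,\circ)$. The restricted direct product of a family of skew braces is the sub-skew brace of the full (unrestricted) direct product consisting of families with only finitely many non-zero entries. Empty direct products are the zero skew brace. *)

theory Defs
  imports "HOL-Computational_Algebra.Primes" "HOL-Algebra.Chinese_Remainder" "HOL-Algebra.Product_Groups"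
begin

text \<open>
  A skew brace is carried by the record type of \<^theory>\<open>HOL-Algebra.Ring\<close>: \<open>\<oplus>\<close>, \<open>\<zero>\<close>, \<open>\<ominus>\<close> are the
  (possibly non-abelian) additive group and \<open>\<otimes>\<close>, \<open>\<one>\<close> the circle group. The equality \<open>\<zero> = \<one>\<close> is a
  consequence of the axioms.
\<close>

locale skew_brace =
  fixes B (structure)
  assumes add_group: "group (add_monoid B)"
    and circ_group: "group B"
    and brace_distrib: "\<lbrakk>a \<in> carrier B; b \<in> carrier B; c \<in> carrier B\<rbrakk>
      \<Longrightarrow> a \<otimes> (b \<oplus> c) = ((a \<otimes> b) \<ominus> a) \<oplus> (a \<otimes> c)"

locale trivial_brace = skew_brace +
  assumes add_comm_group: "comm_group (add_monoid B)"
    and circ_eq_add: "\<lbrakk>a \<in> carrier B; b \<in> carrier B\<rbrakk> \<Longrightarrow> a \<otimes> b = a \<oplus> b"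

definition brace_lambda :: "('a, 'm) ring_scheme \<Rightarrow> 'a \<Rightarrow> 'a \<Rightarrow> 'a"
  where "brace_lambda B a b = (\<ominus>\<^bsub>B\<^esub> a) \<oplus>\<^bsub>B\<^esub> (a \<otimes>\<^bsub>B\<^esub> b)"

definition brace_star :: "('a, 'm) ring_scheme \<Rightarrow> 'a \<Rightarrow> 'a \<Rightarrow> 'a"
  where "brace_star B a b = brace_lambda B a b \<ominus>\<^bsub>B\<^esub> b"

definition Fix_r :: "('a, 'm) ring_scheme \<Rightarrow> 'a \<Rightarrow> 'a set"
  where "Fix_r B x = {b \<in> carrier B. brace_star B x b = \<zero>\<^bsub>B\<^esub>}"

definition Fix_l :: "('a, 'm) ring_scheme \<Rightarrow> 'a \<Rightarrow> 'a set"
  where "Fix_l B x = {b \<in> carrier B. brace_star B b x = \<zero>\<^bsub>B\<^esub>}"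

definition centraliser :: "('a, 'm) monoid_scheme \<Rightarrow> 'a \<Rightarrow> 'a set"
  where "centraliser G x = {y \<in> carrier G. x \<otimes>\<^bsub>G\<^esub> y = y \<otimes>\<^bsub>G\<^esub> x}"

definition centre :: "('a, 'm) monoid_scheme \<Rightarrow> 'a set"
  where "centre G = {z \<in> carrier G. \<forall>y \<in> carrier G. z \<otimes>\<^bsub>G\<^esub> y = y \<otimes>\<^bsub>G\<^esub> z}"

definition property_s :: "('a, 'm) ring_scheme \<Rightarrow> 'a \<Rightarrow> bool"
  where "property_s B x \<longleftrightarrow>
    finite (rcosets\<^bsub>add_monoid B\<^esub> (Fix_r B x \<inter> centraliser (add_monoid B) x)) \<and>
    finite (rcosets\<^bsub>B\<^esub> (Fix_l B x \<inter> centraliser B x))"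

definition property_S :: "('a, 'm) ring_scheme \<Rightarrow> bool"
  where "property_S B \<longleftrightarrow> (\<forall>x \<in> carrier B. property_s B x)"

definition brace_ideal :: "'a set \<Rightarrow> ('a, 'm) ring_scheme \<Rightarrow> bool"
  where "brace_ideal I B \<longleftrightarrow>
    I \<lhd> add_monoid B \<and> I \<lhd> B \<and> (\<forall>a \<in> carrier B. brace_lambda B a ` I \<subseteq> I)"

definition maximal_brace_ideal :: "'a set \<Rightarrow> ('a, 'm) ring_scheme \<Rightarrow> bool"
  where "maximal_brace_ideal M B \<longleftrightarrow>
    brace_ideal M B \<and> M \<noteq> carrier B \<and>
    (\<forall>J. brace_ideal J B \<longrightarrow> J \<noteq> carrier B \<longrightarrow> M \<subseteq> J \<longrightarrow> J = M)"

text \<open>The intersection with the carrier gives \<open>Rad B = carrier B\<close> if there is no maximal ideal.\<close>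

definition brace_Rad :: "('a, 'm) ring_scheme \<Rightarrow> 'a set"
  where "brace_Rad B = carrier B \<inter> \<Inter> {M. maximal_brace_ideal M B}"

definition brace_Ann :: "('a, 'm) ring_scheme \<Rightarrow> 'a set"
  where "brace_Ann B =
    {a \<in> carrier B. \<forall>b \<in> carrier B. brace_lambda B a b = b} \<inter> centre (add_monoid B) \<inter> centre B"

text \<open>
  For an ideal \<open>I\<close> the cosets of \<open>I\<close> in the two groups coincide, and both operations of the quotient
  are the products of cosets as sets.
\<close>

definition brace_quot :: "('a, 'm) ring_scheme \<Rightarrow> 'a set \<Rightarrow> 'a set ring"
  where "brace_quot B I =
    \<lparr>carrier = a_rcosets\<^bsub>B\<^esub> I, monoid.mult = set_mult B, one = I, zero = I, add = set_add B\<rparr>"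

definition brace_prod :: "'i set \<Rightarrow> ('i \<Rightarrow> ('a, 'm) ring_scheme) \<Rightarrow> ('i \<Rightarrow> 'a) ring"
  where "brace_prod I F = monoid.extend (product_group I F)
    \<lparr>zero = one (product_group I (\<lambda>i. add_monoid (F i))),
     add = monoid.mult (product_group I (\<lambda>i. add_monoid (F i)))\<rparr>"

definition restricted_brace_prod :: "'i set \<Rightarrow> ('i \<Rightarrow> ('a, 'm) ring_scheme) \<Rightarrow> ('i \<Rightarrow> 'a) ring"
  where "restricted_brace_prod I F = (brace_prod I F)
    \<lparr>carrier := {x \<in> carrier (brace_prod I F). finite {i \<in> I. x i \<noteq> \<zero>\<^bsub>F i\<^esub>}}\<rparr>"

definition nontrivial_simple_image_prod :: "('a, 'm) ring_scheme \<Rightarrow> ('a set \<Rightarrow> 'a set) ring"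
  where "nontrivial_simple_image_prod B =
    restricted_brace_prod {I. maximal_brace_ideal I B \<and> \<not> trivial_brace (brace_quot B I)}
      (brace_quot B)"

definition brace_hom :: "('a, 'm) ring_scheme \<Rightarrow> ('b, 'n) ring_scheme \<Rightarrow> ('a \<Rightarrow> 'b) set"
  where "brace_hom B B' = hom (add_monoid B) (add_monoid B') \<inter> hom B B'"

definition brace_embeds :: "('a, 'm) ring_scheme \<Rightarrow> ('b, 'n) ring_scheme \<Rightarrow> bool"
  where "brace_embeds B B' \<longleftrightarrow> (\<exists>f \<in> brace_hom B B'. inj_on f (carrier B))"

definition brace_isomorphic :: "('a, 'm) ring_scheme \<Rightarrow> ('b, 'n) ring_scheme \<Rightarrow> bool"
  where "brace_isomorphic B B' \<longleftrightarrow>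
    (\<exists>f \<in> brace_hom B B'. bij_betw f (carrier B) (carrier B'))"

text \<open>\<open>A\<close> is an ideal containing \<open>R\<close> with \<open>A/R = Ann(B/R)\<close>, where \<open>A/R\<close> is the set of cosets \<open>R + a\<close>
  with \<open>a \<in> A\<close>.\<close>

definition is_Ann_preimage :: "'a set \<Rightarrow> 'a set \<Rightarrow> ('a, 'm) ring_scheme \<Rightarrow> bool"
  where "is_Ann_preimage A R B \<longleftrightarrow>
    brace_ideal A B \<and> R \<subseteq> A \<and> (\<lambda>a. R +>\<^bsub>B\<^esub> a) ` A = brace_Ann (brace_quot B R)"

end

theory Submission
  imports Defs "HOL-Algebra.Multiplicative_Group"
begin

text \<open>
  Call two elements of a skew brace commuting if all four of \<open>x + y\<close>, \<open>y + x\<close>, \<open>x \<circ> y\<close>, \<open>y \<circ> x\<close> are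
  equal. The annihilator consists of the elements commuting with everything, and a skew brace is a
  trivial brace if and only if any two elements commute. If \<open>M\<close> is a maximal ideal and \<open>B/M\<close> is not a
  trivial brace, two facts follow from the simplicity of \<open>B/M\<close>. The annihilator of \<open>B/M\<close> is zero; and \<open>M\<close> is
  prime, in the sense that it contains an intersection \<open>I \<inter> J\<close> of ideals only if it contains \<open>I\<close> or
  \<open>J\<close> (\<open>maximal_ideal_prime\<close>): elements of \<open>I\<close> commute with elements of \<open>J\<close> modulo \<open>I \<inter> J\<close>.

  Let \<open>\<N>\<close> be the set of these \<open>M\<close>. Primality gives a Chinese remainder theorem for finite subsets of \<open>\<N>\<close>.
  If \<open>x \<notin> M\<close>, then some element of \<open>B/M\<close> does not commute with the image of \<open>x\<close>, so one of the two subgroups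
  of finite index attached to \<open>x\<close> by property (s) does not map onto \<open>B/M\<close>. The Chinese remainder theorem turns many
  such \<open>M\<close> into many cosets. Hence every \<open>x\<close> lies in all but finitely many members of \<open>\<N>\<close>
  (\<open>finite_nontrivial_maximal_ideals_not_containing\<close>), and \<open>b \<mapsto> (M + b)\<close>, \<open>M \<in> \<N>\<close>, maps \<open>B\<close> into the
  restricted product \<open>C\<close>. The finiteness, together with primality, also shows that the intersection of
  all members of \<open>\<N>\<close> other than \<open>M\<close> is not contained in \<open>M\<close>, so this map is onto \<open>C\<close>.
  Its kernel is \<open>A = \<Inter>\<N>\<close>, whence \<open>B/A \<cong> C\<close>.

  For the other maximal ideals, \<open>B/M\<close> is a simple trivial brace, that is, a group of prime
  order. The map from \<open>B\<close> to the product of all \<open>B/M\<close> has kernel \<open>R\<close>, which gives the embedding.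
  Finally, an element annihilates \<open>B/R\<close> if and only if it annihilates every \<open>B/M\<close>, which says nothing
  when \<open>B/M\<close> is trivial and that it is in \<open>M\<close> otherwise. So \<open>A/R\<close> is the annihilator of \<open>B/R\<close> (\<open>is_Ann_preimage_Rad_iff\<close>).
\<close>

section \<open>Arithmetic in skew braces\<close>

sublocale skew_brace \<subseteq> group B
  by (rule circ_group)

sublocale skew_brace \<subseteq> add: group "add_monoid B"
  rewrites "carrier (add_monoid B) = carrier B"
    and "monoid.mult (add_monoid B) = add B"
    and "one (add_monoid B) = zero B"
    and "m_inv (add_monoid B) = a_inv B"
    and "r_coset (add_monoid B) = a_r_coset B"
  by (rule add_group) (auto simp: a_inv_def a_r_coset_def)

context skew_brace
begin

lemma add_left_cancel [simp]:
  "\<lbrakk>a \<in> carrier B; b \<in> carrier B; c \<in> carrier B\<rbrakk> \<Longrightarrow> a \<oplus> b = a \<oplus> c \<longleftrightarrow> b = c"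
  by (metis add.inv_solve_left add.m_closed)

lemma add_neg_cancel [simp]:
  assumes "a \<in> carrier B" "b \<in> carrier B"
  shows "\<ominus> a \<oplus> (a \<oplus> b) = b" and "a \<oplus> (\<ominus> a \<oplus> b) = b"
  using assms by (simp_all flip: add.m_assoc)

lemma zero_eq_one: "\<zero> = \<one>"
proof -
  have *: "a \<otimes> \<zero> = a" if a: "a \<in> carrier B" for a
  proof -
    have "a \<otimes> (\<zero> \<oplus> \<zero>) = (a \<otimes> \<zero> \<ominus> a) \<oplus> a \<otimes> \<zero>"
      using a by (intro brace_distrib) auto
    then have "\<zero> \<oplus> a \<otimes> \<zero> = (a \<otimes> \<zero> \<ominus> a) \<oplus> a \<otimes> \<zero>"
      using a by simp
    then have "a \<otimes> \<zero> \<oplus> \<ominus> a = \<zero>"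
      using a by (metis add.inv_closed add.m_closed add.one_closed add.right_cancel a_minus_def m_closed)
    then show ?thesis
      using a by (metis add.inv_closed add.inv_inv add.inv_equality add.one_closed m_closed)
  qed
  from *[of "\<one>"] show ?thesis by simp
qed

lemma lambda_closed [simp]:
  "\<lbrakk>a \<in> carrier B; b \<in> carrier B\<rbrakk> \<Longrightarrow> brace_lambda B a b \<in> carrier B"
  by (simp add: brace_lambda_def)

lemma circ_eq_add_lambda:
  "\<lbrakk>a \<in> carrier B; b \<in> carrier B\<rbrakk> \<Longrightarrow> a \<otimes> b = a \<oplus> brace_lambda B a b"
  by (simp add: brace_lambda_def)

lemma lambda_add:
  assumes "a \<in> carrier B" "b \<in> carrier B" "c \<in> carrier B"
  shows "brace_lambda B a (b \<oplus> c) = brace_lambda B a b \<oplus> brace_lambda B a c"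
  using assms by (simp add: brace_lambda_def brace_distrib a_minus_def add.m_assoc)

lemma lambda_lambda:
  assumes a: "a \<in> carrier B" and b: "b \<in> carrier B" and c: "c \<in> carrier B"
  shows "brace_lambda B a (brace_lambda B b c) = brace_lambda B (a \<otimes> b) c"
proof -
  have "brace_lambda B a (b \<otimes> c) = brace_lambda B a b \<oplus> brace_lambda B a (brace_lambda B b c)"
    using a b c by (subst circ_eq_add_lambda[OF b c]) (simp add: lambda_add)
  then have "a \<oplus> brace_lambda B a (b \<otimes> c)
      = a \<oplus> brace_lambda B a b \<oplus> brace_lambda B a (brace_lambda B b c)"
    using a b c by (simp add: add.m_assoc)
  then have "a \<otimes> (b \<otimes> c) = (a \<otimes> b) \<oplus> brace_lambda B a (brace_lambda B b c)"
    using a b c by (simp flip: circ_eq_add_lambda)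
  moreover have "a \<otimes> (b \<otimes> c) = (a \<otimes> b) \<oplus> brace_lambda B (a \<otimes> b) c"
    using a b c by (simp add: m_assoc flip: circ_eq_add_lambda)
  ultimately show ?thesis
    using a b c by simp
qed

lemma lambda_one: "b \<in> carrier B \<Longrightarrow> brace_lambda B \<one> b = b"
  using circ_eq_add_lambda[of \<one> b] l_one[of b] by (simp flip: zero_eq_one)

lemma lambda_inverse:
  assumes "a \<in> carrier B" "b \<in> carrier B"
  shows "brace_lambda B a (brace_lambda B (inv a) b) = b"
  using assms by (simp add: lambda_lambda lambda_one)

end

section \<open>Commuting elements and the annihilator\<close>

text \<open>Equivalently, both group commutators of \<open>x\<close> and \<open>y\<close> and both of \<open>x * y\<close>, \<open>y * x\<close> vanish. In this
  form the annihilator, trivial braces and property (s) become statements about one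
  symmetric relation, and no \<open>\<lambda>\<close> has to be carried through quotients.\<close>

definition brace_commute :: "('a, 'm) ring_scheme \<Rightarrow> 'a \<Rightarrow> 'a \<Rightarrow> bool"
  where "brace_commute B x y \<longleftrightarrow>
    x \<oplus>\<^bsub>B\<^esub> y = y \<oplus>\<^bsub>B\<^esub> x \<and> x \<otimes>\<^bsub>B\<^esub> y = x \<oplus>\<^bsub>B\<^esub> y \<and> y \<otimes>\<^bsub>B\<^esub> x = x \<oplus>\<^bsub>B\<^esub> y"

context skew_brace
begin

lemma lambda_eq_iff:
  assumes "a \<in> carrier B" "b \<in> carrier B"
  shows "brace_lambda B a b = b \<longleftrightarrow> a \<otimes> b = a \<oplus> b"
  using assms by (simp add: circ_eq_add_lambda)

lemma star_eq_zero_iff: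
  assumes "a \<in> carrier B" "b \<in> carrier B"
  shows "brace_star B a b = \<zero> \<longleftrightarrow> a \<otimes> b = a \<oplus> b"
proof -
  have "brace_star B a b = \<zero> \<longleftrightarrow> brace_lambda B a b = b"
    using assms unfolding brace_star_def a_minus_def
    by (metis add.inv_closed add.inv_equality add.inv_inv add.r_inv lambda_closed)
  then show ?thesis
    using assms by (simp add: lambda_eq_iff)
qed

lemma Fix_r_Int_centraliser:
  "x \<in> carrier B \<Longrightarrow> Fix_r B x \<inter> centraliser (add_monoid B) x
    = {b \<in> carrier B. x \<otimes> b = x \<oplus> b \<and> x \<oplus> b = b \<oplus> x}"
  by (auto simp: Fix_r_def centraliser_def star_eq_zero_iff)

lemma Fix_l_Int_centraliser:
  "x \<in> carrier B \<Longrightarrow> Fix_l B x \<inter> centraliser B x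
    = {b \<in> carrier B. b \<otimes> x = b \<oplus> x \<and> x \<otimes> b = b \<otimes> x}"
  by (auto simp: Fix_l_def centraliser_def star_eq_zero_iff)

lemma brace_commute_zero:
  "x \<in> carrier B \<Longrightarrow> brace_commute B x \<zero>" "x \<in> carrier B \<Longrightarrow> brace_commute B \<zero> x"
  using l_one[of x] r_one[of x] by (simp_all add: brace_commute_def flip: zero_eq_one)

lemma brace_Ann_eq: "brace_Ann B = {a \<in> carrier B. \<forall>b \<in> carrier B. brace_commute B a b}"
  by (auto simp: brace_Ann_def centre_def lambda_eq_iff brace_commute_def)

lemma trivial_brace_iff:
  "trivial_brace B \<longleftrightarrow> (\<forall>a \<in> carrier B. \<forall>b \<in> carrier B. brace_commute B a b)"
proof
  assume "trivial_brace B"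
  then interpret trivial_brace B .
  interpret A: comm_group "add_monoid B" by (rule add_comm_group)
  show "\<forall>a \<in> carrier B. \<forall>b \<in> carrier B. brace_commute B a b"
    using A.m_comm by (auto simp: brace_commute_def circ_eq_add)
next
  assume *: "\<forall>a \<in> carrier B. \<forall>b \<in> carrier B. brace_commute B a b"
  have "comm_group (add_monoid B)"
    by (rule group.group_comm_groupI[OF add_group]) (use * in \<open>auto simp: brace_commute_def\<close>)
  then show "trivial_brace B"
    using * by unfold_locales (auto simp: brace_commute_def comm_group_def comm_monoid_def
        comm_monoid_axioms_def)
qed

end

section \<open>Ideals and quotients\<close>

context skew_brace
begin

lemma brace_idealI:
  assumes "subgroup I (add_monoid B)" and "subgroup I B"
    and "\<And>a i. \<lbrakk>a \<in> carrier B; i \<in> I\<rbrakk> \<Longrightarrow> a \<oplus> i \<oplus> \<ominus> a \<in> I"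
    and "\<And>a i. \<lbrakk>a \<in> carrier B; i \<in> I\<rbrakk> \<Longrightarrow> a \<otimes> i \<otimes> inv a \<in> I"
    and "\<And>a i. \<lbrakk>a \<in> carrier B; i \<in> I\<rbrakk> \<Longrightarrow> brace_lambda B a i \<in> I"
  shows "brace_ideal I B"
  using assms by (auto simp: brace_ideal_def normal_inv_iff add.normal_inv_iff)

lemma brace_idealD:
  assumes "brace_ideal I B"
  shows "subgroup I (add_monoid B)" and "subgroup I B"
    and "\<And>a i. \<lbrakk>a \<in> carrier B; i \<in> I\<rbrakk> \<Longrightarrow> a \<oplus> i \<oplus> \<ominus> a \<in> I"
    and "\<And>a i. \<lbrakk>a \<in> carrier B; i \<in> I\<rbrakk> \<Longrightarrow> a \<otimes> i \<otimes> inv a \<in> I"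
    and "\<And>a i. \<lbrakk>a \<in> carrier B; i \<in> I\<rbrakk> \<Longrightarrow> brace_lambda B a i \<in> I"
    and "I \<subseteq> carrier B" and "\<zero> \<in> I"
  using assms subgroup.subset[of I B] subgroup.one_closed[of I "add_monoid B"]
  by (auto simp: brace_ideal_def normal_inv_iff add.normal_inv_iff image_subset_iff)

lemma brace_ideal_carrier: "brace_ideal (carrier B) B"
  by (rule brace_idealI) (auto intro: subgroup_self add.subgroup_self)

lemma brace_ideal_Inter:
  assumes "\<And>I. I \<in> S \<Longrightarrow> brace_ideal I B"
  shows "brace_ideal (carrier B \<inter> \<Inter> S) B"
proof -
  let ?T = "insert (carrier B) S"
  have T: "brace_ideal I B" if "I \<in> ?T" for I
    using that assms brace_ideal_carrier by auto
  have "brace_ideal (\<Inter> ?T) B"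
  proof (rule brace_idealI)
    show "subgroup (\<Inter> ?T) B" 
      by (rule subgroups_Inter) (use T in \<open>auto dest: brace_idealD\<close>)
    show "subgroup (\<Inter> ?T) (add_monoid B)" 
      by (rule add.subgroups_Inter) (use T in \<open>auto dest: brace_idealD\<close>)
  qed (use assms in \<open>auto dest: brace_idealD\<close>)
  then show ?thesis by simp
qed

text \<open>By normality both cosets may be written as left cosets, and \<open>a \<otimes> i = a \<oplus> \<lambda>\<^sub>a(i)\<close>, where \<open>\<lambda>\<^sub>a\<close>
  permutes the ideal.\<close>

lemma r_coset_eq_a_r_coset:
  assumes I: "brace_ideal I B" and a: "a \<in> carrier B"
  shows "I #> a = I +> a"
proof -
  have 1: "I #> a = a <# I" and 2: "I +> a = l_coset (add_monoid B) a I"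
    using I a unfolding brace_ideal_def by (simp_all add: normal.coset_eq a_r_coset_def)
  have sub: "i \<in> carrier B" if "i \<in> I" for i
    using that brace_idealD(6)[OF I] by auto
  have "a <# I = l_coset (add_monoid B) a I"
  proof
    show "a <# I \<subseteq> l_coset (add_monoid B) a I"
      using a sub brace_idealD(5)[OF I] by (auto simp: l_coset_def circ_eq_add_lambda)
    show "l_coset (add_monoid B) a I \<subseteq> a <# I"
    proof
      fix y assume "y \<in> l_coset (add_monoid B) a I"
      then obtain i where i: "i \<in> I" "y = a \<oplus> i"
        by (auto simp: l_coset_def)
      have "y = a \<otimes> brace_lambda B (inv a) i"
        using a i sub by (simp add: circ_eq_add_lambda lambda_inverse)
      then show "y \<in> a <# I"
        using i a brace_idealD(5)[OF I] by (auto simp: l_coset_def)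
    qed
  qed
  with 1 2 show ?thesis by simp
qed

end

text \<open>Quotients are surjective images, so their skew brace axioms are inherited from \<open>B\<close> at once.\<close>

lemma skew_brace_surjective_image:
  assumes "skew_brace B" and surj: "h ` carrier B = carrier Q"
    and add: "\<And>a b. \<lbrakk>a \<in> carrier B; b \<in> carrier B\<rbrakk> \<Longrightarrow> h (a \<oplus>\<^bsub>B\<^esub> b) = h a \<oplus>\<^bsub>Q\<^esub> h b"
    and mult: "\<And>a b. \<lbrakk>a \<in> carrier B; b \<in> carrier B\<rbrakk> \<Longrightarrow> h (a \<otimes>\<^bsub>B\<^esub> b) = h a \<otimes>\<^bsub>Q\<^esub> h b"
    and zero: "h \<zero>\<^bsub>B\<^esub> = \<zero>\<^bsub>Q\<^esub>" and one: "h \<one>\<^bsub>B\<^esub> = \<one>\<^bsub>Q\<^esub>"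
  shows "skew_brace Q"
proof -
  interpret B: skew_brace B by fact
  have obt: "\<exists>a \<in> carrier B. x = h a" if "x \<in> carrier Q" for x
    using that surj by auto
  have img: "h a \<in> carrier Q" if "a \<in> carrier B" for a
    using that surj by auto
  have addg: "group (add_monoid Q)"
  proof (rule groupI; simp)
    fix x y z assume "x \<in> carrier Q" "y \<in> carrier Q" "z \<in> carrier Q"
    then obtain a b c where "a \<in> carrier B" "b \<in> carrier B" "c \<in> carrier B" "x = h a" "y = h b" "z = h c"
      using obt by metis
    then show "x \<oplus>\<^bsub>Q\<^esub> y \<oplus>\<^bsub>Q\<^esub> z = x \<oplus>\<^bsub>Q\<^esub> (y \<oplus>\<^bsub>Q\<^esub> z)"
      by (simp add: B.add.m_assoc flip: add)
  next
    fix x y assume "x \<in> carrier Q" "y \<in> carrier Q"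
    then obtain a b where "a \<in> carrier B" "b \<in> carrier B" "x = h a" "y = h b"
      using obt by metis
    then show "x \<oplus>\<^bsub>Q\<^esub> y \<in> carrier Q"
      by (simp add: img flip: add)
  next
    show "\<zero>\<^bsub>Q\<^esub> \<in> carrier Q" using img[OF B.add.one_closed] by (simp add: zero)
  next
    fix x assume "x \<in> carrier Q"
    then obtain a where a: "a \<in> carrier B" "x = h a"
      using obt by metis
    show "\<zero>\<^bsub>Q\<^esub> \<oplus>\<^bsub>Q\<^esub> x = x"
      using a by (simp flip: add zero)
    show "\<exists>y\<in>carrier Q. y \<oplus>\<^bsub>Q\<^esub> x = \<zero>\<^bsub>Q\<^esub>"
      by (rule bexI[of _ "h (\<ominus>\<^bsub>B\<^esub> a)"]) (use a in \<open>simp_all add: img flip: add zero\<close>)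
  qed
  have multg: "group Q"
  proof (rule groupI)
    fix x y z assume "x \<in> carrier Q" "y \<in> carrier Q" "z \<in> carrier Q"
    then obtain a b c where "a \<in> carrier B" "b \<in> carrier B" "c \<in> carrier B" "x = h a" "y = h b" "z = h c"
      using obt by metis
    then show "x \<otimes>\<^bsub>Q\<^esub> y \<otimes>\<^bsub>Q\<^esub> z = x \<otimes>\<^bsub>Q\<^esub> (y \<otimes>\<^bsub>Q\<^esub> z)"
      by (simp add: B.m_assoc flip: mult)
  next
    fix x y assume "x \<in> carrier Q" "y \<in> carrier Q"
    then obtain a b where "a \<in> carrier B" "b \<in> carrier B" "x = h a" "y = h b"
      using obt by metis
    then show "x \<otimes>\<^bsub>Q\<^esub> y \<in> carrier Q"
      by (simp add: img flip: mult)
  next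
    show "\<one>\<^bsub>Q\<^esub> \<in> carrier Q" using img[OF B.one_closed] by (simp add: one)
  next
    fix x assume "x \<in> carrier Q"
    then obtain a where a: "a \<in> carrier B" "x = h a"
      using obt by metis
    show "\<one>\<^bsub>Q\<^esub> \<otimes>\<^bsub>Q\<^esub> x = x"
      using a by (simp flip: mult one)
    show "\<exists>y\<in>carrier Q. y \<otimes>\<^bsub>Q\<^esub> x = \<one>\<^bsub>Q\<^esub>"
      by (rule bexI[of _ "h (inv\<^bsub>B\<^esub> a)"]) (use a in \<open>simp_all add: img flip: mult one\<close>)
  qed
  have neg: "\<ominus>\<^bsub>Q\<^esub> h a = h (\<ominus>\<^bsub>B\<^esub> a)" if "a \<in> carrier B" for a
    using that group.inv_equality[OF addg, of "h (\<ominus>\<^bsub>B\<^esub> a)" "h a"]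
    by (simp add: img a_inv_def[of Q] zero flip: add)
  show ?thesis
  proof (intro skew_brace.intro addg multg)
    fix x y z assume "x \<in> carrier Q" "y \<in> carrier Q" "z \<in> carrier Q"
    then obtain a b c where "a \<in> carrier B" "b \<in> carrier B" "c \<in> carrier B" "x = h a" "y = h b" "z = h c"
      using obt by metis
    then show "x \<otimes>\<^bsub>Q\<^esub> (y \<oplus>\<^bsub>Q\<^esub> z) = (x \<otimes>\<^bsub>Q\<^esub> y \<ominus>\<^bsub>Q\<^esub> x) \<oplus>\<^bsub>Q\<^esub> (x \<otimes>\<^bsub>Q\<^esub> z)"
      by (simp add: a_minus_def neg B.brace_distrib flip: add mult)
  qed
qed

context skew_brace
begin

lemma quot_simps [simp]:
  "zero (brace_quot B I) = I" "one (brace_quot B I) = I"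
  by (simp_all add: brace_quot_def)

lemma carrier_quot: "carrier (brace_quot B I) = (\<lambda>a. I +> a) ` carrier B"
  by (auto simp: brace_quot_def A_RCOSETS_def' image_def)

lemma quot_add:
  assumes "brace_ideal I B" "a \<in> carrier B" "b \<in> carrier B"
  shows "(I +> a) \<oplus>\<^bsub>brace_quot B I\<^esub> (I +> b) = I +> (a \<oplus> b)"
  using assms normal.rcos_sum[of I "add_monoid B" a b]
  by (simp add: brace_quot_def brace_ideal_def set_add_def a_r_coset_def)

lemma quot_mult:
  assumes "brace_ideal I B" "a \<in> carrier B" "b \<in> carrier B"
  shows "(I +> a) \<otimes>\<^bsub>brace_quot B I\<^esub> (I +> b) = I +> (a \<otimes> b)"
  using assms normal.rcos_sum[of I B a b]
  by (simp add: brace_quot_def brace_ideal_def flip: r_coset_eq_a_r_coset)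

lemma coset_eq_iff:
  assumes "brace_ideal I B" "a \<in> carrier B" "b \<in> carrier B"
  shows "I +> a = I +> b \<longleftrightarrow> a \<ominus> b \<in> I"
  using subgroup.rcos_module[OF brace_idealD(1)[OF assms(1)] add_group, of b a]
    add.repr_independence[OF _ _ brace_idealD(1)[OF assms(1)], of a b]
    add.repr_independenceD[OF brace_idealD(1)[OF assms(1)], of a b] assms
  by (auto simp: a_minus_def a_inv_def a_r_coset_def)

lemma coset_eq_ideal_iff:
  assumes "brace_ideal I B" "a \<in> carrier B"
  shows "I +> a = I \<longleftrightarrow> a \<in> I"
  using add.coset_join1 add.coset_join2 brace_idealD(1)[OF assms(1)] assms(2) by metis

lemma skew_brace_quot: 
  assumes I: "brace_ideal I B"
  shows "skew_brace (brace_quot B I)"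
proof (rule skew_brace_surjective_image[OF skew_brace_axioms])
  show "(\<lambda>a. I +> a) ` carrier B = carrier (brace_quot B I)" by (simp add: carrier_quot)
  show "I +> \<zero> = \<zero>\<^bsub>brace_quot B I\<^esub>" "I +> \<one> = \<one>\<^bsub>brace_quot B I\<^esub>"
    using I brace_idealD(7)[OF I] by (simp_all add: coset_eq_ideal_iff flip: zero_eq_one)
qed (use I in \<open>simp_all add: quot_add quot_mult\<close>)

end

section \<open>Homomorphisms\<close>

locale brace_morphism = B: skew_brace B + Q: skew_brace Q
  for B (structure) and Q (structure) +
  fixes h
  assumes hom: "h \<in> brace_hom B Q"
begin

sublocale circ: group_hom B Q h
  using hom by unfold_locales (simp add: brace_hom_def)

sublocale add: group_hom "add_monoid B" "add_monoid Q" h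
  rewrites "carrier (add_monoid B) = carrier B"
    and "monoid.mult (add_monoid B) = add B"
    and "one (add_monoid B) = zero B"
    and "m_inv (add_monoid B) = a_inv B"
    and "carrier (add_monoid Q) = carrier Q"
    and "monoid.mult (add_monoid Q) = add Q"
    and "one (add_monoid Q) = zero Q"
    and "m_inv (add_monoid Q) = a_inv Q"
  using hom B.add_group Q.add_group
  by (auto simp: brace_hom_def a_inv_def group_hom_def group_hom_axioms_def)

lemma hom_lambda:
  "\<lbrakk>a \<in> carrier B; b \<in> carrier B\<rbrakk> \<Longrightarrow> h (brace_lambda B a b) = brace_lambda Q (h a) (h b)"
  by (simp add: brace_lambda_def)

lemma brace_ideal_preimage:
  assumes K: "brace_ideal K Q"
  shows "brace_ideal {a \<in> carrier B. h a \<in> K} B"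
proof (rule B.brace_idealI)
  note K = Q.brace_idealD[OF K]
  note sub = subgroup.m_closed[OF K(1), simplified] subgroup.m_inv_closed[OF K(1), folded a_inv_def]
    subgroup.m_closed[OF K(2)] subgroup.m_inv_closed[OF K(2)]
  show "subgroup {a \<in> carrier B. h a \<in> K} (add_monoid B)"
    by (rule B.add.subgroupI) (use K sub in \<open>auto intro: exI[of _ "\<zero>\<^bsub>B\<^esub>"]\<close>)
  show "subgroup {a \<in> carrier B. h a \<in> K} B"
    by (rule B.subgroupI) (use K sub Q.zero_eq_one in \<open>auto intro: exI[of _ "\<one>\<^bsub>B\<^esub>"]\<close>)
qed (use Q.brace_idealD[OF K] in \<open>auto simp: hom_lambda\<close>)

lemma brace_ideal_image:
  assumes I: "brace_ideal I B" and surj: "h ` carrier B = carrier Q"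
  shows "brace_ideal (h ` I) Q"
proof (rule Q.brace_idealI)
  note I = B.brace_idealD[OF I]
  have sub: "i \<in> carrier B" if "i \<in> I" for i
    using that I by auto
  show "subgroup (h ` I) (add_monoid Q)" "subgroup (h ` I) Q"
    using I add.subgroup_img_is_subgroup circ.subgroup_img_is_subgroup by auto
  fix x y assume "x \<in> carrier Q" "y \<in> h ` I"
  then obtain a i where a: "a \<in> carrier B" "i \<in> I" "x = h a" "y = h i"
    using surj by (metis imageE)
  show "x \<oplus>\<^bsub>Q\<^esub> y \<oplus>\<^bsub>Q\<^esub> \<ominus>\<^bsub>Q\<^esub> x \<in> h ` I"
    by (rule image_eqI[of _ _ "a \<oplus>\<^bsub>B\<^esub> i \<oplus>\<^bsub>B\<^esub> \<ominus>\<^bsub>B\<^esub> a"]) (use a I sub in auto)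
  show "x \<otimes>\<^bsub>Q\<^esub> y \<otimes>\<^bsub>Q\<^esub> inv\<^bsub>Q\<^esub> x \<in> h ` I"
    by (rule image_eqI[of _ _ "a \<otimes>\<^bsub>B\<^esub> i \<otimes>\<^bsub>B\<^esub> inv\<^bsub>B\<^esub> a"]) (use a I sub in auto)
  show "brace_lambda Q x y \<in> h ` I"
    by (rule image_eqI[of _ _ "brace_lambda B a i"]) (use a I sub in \<open>auto simp: hom_lambda\<close>)
qed

end

text \<open>If \<open>I\<close> is the kernel of \<open>h\<close>, then \<open>h\<close> is constant on each coset of \<open>I\<close>, so the unique value
  on a coset defines the induced injection on the quotient.\<close>

lemma (in skew_brace)
  assumes I: "brace_ideal I B" and h: "h \<in> brace_hom B Q"
    and ker: "\<And>a b. \<lbrakk>a \<in> carrier B; b \<in> carrier B\<rbrakk> \<Longrightarrow> h a = h b \<longleftrightarrow> I +> a = I +> b"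
  shows brace_embeds_quotI: "brace_embeds (brace_quot B I) Q"
    and brace_isomorphic_quotI: "h ` carrier B = carrier Q \<Longrightarrow> brace_isomorphic (brace_quot B I) Q"
proof -
  define f where "f = (\<lambda>X. the_elem (h ` X))"
  have f: "f (I +> a) = h a" if a: "a \<in> carrier B" for a
  proof -
    have "h x = h a" if x: "x \<in> I +> a" for x
    proof -
      have "x \<in> carrier B"
        using x a brace_idealD(6)[OF I] by (auto simp: a_r_coset_def')
      moreover have "I +> a = I +> x"
        by (rule add.repr_independence) (use x a brace_idealD(1)[OF I] in auto)
      ultimately show ?thesis
        using ker a by metis
    qed
    moreover have "a \<in> I +> a"
      using a brace_idealD(1)[OF I] by (rule add.rcos_self)
    ultimately have "h ` (I +> a) = {h a}" by blast
    then show ?thesis by (simp add: f_def)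
  qed
  have hom: "f \<in> brace_hom (brace_quot B I) Q"
    using h by (auto simp: brace_hom_def hom_def carrier_quot f quot_add[OF I] quot_mult[OF I] Pi_iff)
  have inj: "inj_on f (carrier (brace_quot B I))"
    using ker by (auto simp: inj_on_def carrier_quot f)
  show "brace_embeds (brace_quot B I) Q"
    using hom inj by (auto simp: brace_embeds_def)
  have "f ` carrier (brace_quot B I) = h ` carrier B"
    by (simp add: carrier_quot image_image f)
  then show "brace_isomorphic (brace_quot B I) Q" if "h ` carrier B = carrier Q"
    using hom inj that by (auto simp: brace_isomorphic_def bij_betw_def)
qed

context skew_brace
begin

lemma coset_morphism:
  assumes I: "brace_ideal I B"
  shows "brace_morphism B (brace_quot B I) (\<lambda>a. I +> a)"
proof -
  interpret Q: skew_brace "brace_quot B I" by (rule skew_brace_quot[OF I])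
  show ?thesis
    by unfold_locales (auto simp: brace_hom_def hom_def carrier_quot quot_add[OF I] quot_mult[OF I])
qed

lemma brace_commute_quot_iff:
  assumes "brace_ideal I B" "a \<in> carrier B" "b \<in> carrier B"
  shows "brace_commute (brace_quot B I) (I +> a) (I +> b) \<longleftrightarrow>
    I +> (a \<oplus> b) = I +> (b \<oplus> a) \<and> I +> (a \<otimes> b) = I +> (a \<oplus> b) \<and> I +> (b \<otimes> a) = I +> (a \<oplus> b)"
  using assms by (simp add: brace_commute_def quot_add quot_mult)

lemma coset_Inter_eq_iff:
  assumes S: "\<And>I. I \<in> S \<Longrightarrow> brace_ideal I B" and a: "a \<in> carrier B" "b \<in> carrier B"
  shows "(carrier B \<inter> \<Inter> S) +> a = (carrier B \<inter> \<Inter> S) +> b \<longleftrightarrow> (\<forall>I \<in> S. I +> a = I +> b)"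
proof -
  have "a \<ominus> b \<in> carrier B"
    using a by (simp add: a_minus_def)
  then have "a \<ominus> b \<in> carrier B \<inter> \<Inter> S \<longleftrightarrow> (\<forall>I \<in> S. a \<ominus> b \<in> I)"
    by simp
  moreover have "a \<ominus> b \<in> I \<longleftrightarrow> I +> a = I +> b" if "I \<in> S" for I
    using coset_eq_iff[OF S[OF that] a] by simp
  ultimately show ?thesis
    using coset_eq_iff[OF brace_ideal_Inter[OF S] a] by simp
qed

lemma brace_commute_quot_Inter:
  assumes S: "\<And>I. I \<in> S \<Longrightarrow> brace_ideal I B" and a: "a \<in> carrier B" "b \<in> carrier B"
  shows "brace_commute (brace_quot B (carrier B \<inter> \<Inter> S))
      ((carrier B \<inter> \<Inter> S) +> a) ((carrier B \<inter> \<Inter> S) +> b) \<longleftrightarrow>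
    (\<forall>I \<in> S. brace_commute (brace_quot B I) (I +> a) (I +> b))"
proof -
  have "(\<forall>I \<in> S. brace_commute (brace_quot B I) (I +> a) (I +> b)) \<longleftrightarrow>
      (\<forall>I \<in> S. I +> (a \<oplus> b) = I +> (b \<oplus> a)) \<and> (\<forall>I \<in> S. I +> (a \<otimes> b) = I +> (a \<oplus> b)) \<and>
      (\<forall>I \<in> S. I +> (b \<otimes> a) = I +> (a \<oplus> b))"
    using brace_commute_quot_iff[OF S a] by blast
  then show ?thesis
    using a by (simp only: brace_commute_quot_iff[OF brace_ideal_Inter[OF S] a]
        coset_Inter_eq_iff[OF S] m_closed add.m_closed)
qed

text \<open>If \<open>a\<close> annihilates \<open>B\<close>, then \<open>a \<oplus> b = a \<otimes> b = b \<otimes> a\<close> for all \<open>b\<close>. So sums with \<open>a\<close> may be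
  rewritten as circle products, to which associativity of \<open>\<otimes>\<close> applies; in particular the two
  inverses of \<open>a\<close> coincide. Conjugations and \<open>\<lambda>\<^sub>b\<close> fix \<open>a\<close>.\<close>

lemma brace_ideal_Ann: "brace_ideal (brace_Ann B) B"
proof (rule brace_idealI)
  let ?Z = "brace_Ann B"
  have Z: "a \<in> carrier B" "\<And>b. b \<in> carrier B \<Longrightarrow> b \<oplus> a = a \<oplus> b"
    "\<And>b. b \<in> carrier B \<Longrightarrow> a \<otimes> b = a \<oplus> b" "\<And>b. b \<in> carrier B \<Longrightarrow> b \<otimes> a = a \<oplus> b" if "a \<in> ?Z" for a
    using that by (auto simp: brace_Ann_eq brace_commute_def)
  have ZI: "a \<in> ?Z" if "a \<in> carrier B" "\<And>b. b \<in> carrier B \<Longrightarrow> b \<oplus> a = a \<oplus> b"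
    "\<And>b. b \<in> carrier B \<Longrightarrow> a \<otimes> b = a \<oplus> b" "\<And>b. b \<in> carrier B \<Longrightarrow> b \<otimes> a = a \<oplus> b" for a
    using that by (auto simp: brace_Ann_eq brace_commute_def)
  have zero: "\<zero> \<in> ?Z"
    by (auto simp: brace_Ann_eq brace_commute_zero)
  have plus: "a \<oplus> b \<in> ?Z" if a: "a \<in> ?Z" and b: "b \<in> ?Z" for a b
  proof (rule ZI)
    note a = Z[OF a] and b = Z[OF b]
    show "a \<oplus> b \<in> carrier B" using a(1) b(1) by simp
    fix c assume c: "c \<in> carrier B"
    show "c \<oplus> (a \<oplus> b) = a \<oplus> b \<oplus> c"
      using a(1) b(1) a(2)[OF c] b(2)[OF c] c by (metis add.m_assoc)
    have "(a \<otimes> b) \<otimes> c = a \<otimes> (b \<otimes> c)"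
      using a(1) b(1) c by (rule m_assoc)
    then show "(a \<oplus> b) \<otimes> c = a \<oplus> b \<oplus> c"
      using a(1) b(1) c a(3)[of b] b(3)[of c] a(3)[of "b \<oplus> c"] by (simp add: add.m_assoc)
    have "(c \<otimes> b) \<otimes> a = c \<otimes> (b \<otimes> a)"
      using c b(1) a(1) by (rule m_assoc)
    then show "c \<otimes> (a \<oplus> b) = a \<oplus> b \<oplus> c"
      using a(1) b(1) c a(4)[of b] b(4)[of c] a(4)[of "b \<oplus> c"] by (simp add: add.m_assoc)
  qed
  have neg: "\<ominus> a \<in> ?Z" if a: "a \<in> ?Z" for a
  proof (rule ZI)
    note Z = Z[OF a]
    show "\<ominus> a \<in> carrier B" using Z(1) by simp
    have inv: "a \<otimes> \<ominus> a = \<one>" using Z(1,3) by (simp add: zero_eq_one)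
    have inv': "\<ominus> a \<otimes> a = \<one>" using Z(1,4) by (simp add: zero_eq_one)
    fix c assume c: "c \<in> carrier B"
    have comm: "\<ominus> a \<oplus> c = c \<oplus> \<ominus> a"
      using Z(1) Z(2)[of "\<ominus> a \<oplus> c"] c
      by (metis add.inv_closed add.inv_solve_right add.m_closed add_neg_cancel(2))
    then show "c \<oplus> \<ominus> a = \<ominus> a \<oplus> c" by simp
    have "a \<otimes> (\<ominus> a \<oplus> c) = c"
      using Z(1) Z(3)[of "\<ominus> a \<oplus> c"] c by simp
    then have "\<ominus> a \<otimes> c = \<ominus> a \<otimes> (a \<otimes> (\<ominus> a \<oplus> c))"
      by simp
    also have "\<dots> = \<ominus> a \<oplus> c"
      using Z(1) c inv' by (simp flip: m_assoc)
    finally show "\<ominus> a \<otimes> c = \<ominus> a \<oplus> c" .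
    have "(\<ominus> a \<oplus> c) \<otimes> a = c"
      using Z(1) Z(4)[of "\<ominus> a \<oplus> c"] c by simp
    then have "c \<otimes> \<ominus> a = ((\<ominus> a \<oplus> c) \<otimes> a) \<otimes> \<ominus> a"
      by simp
    also have "\<dots> = \<ominus> a \<oplus> c"
      using Z(1) c inv by (simp add: m_assoc)
    finally show "c \<otimes> \<ominus> a = \<ominus> a \<oplus> c" .
  qed
  have inv: "inv a = \<ominus> a" if "a \<in> ?Z" for a
    using Z(1)[OF that] Z(4)[OF that, of "\<ominus> a"] by (intro inv_equality) (simp_all add: zero_eq_one)
  show "subgroup ?Z (add_monoid B)"
    by (rule add.subgroupI) (use zero Z(1) plus neg in auto)
  show "subgroup ?Z B"
    by (rule subgroupI) (use zero Z(1,3) plus neg inv in \<open>auto simp del: m_closed\<close>)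
  fix a i assume a: "a \<in> carrier B" and i: "i \<in> ?Z"
  note Z = Z[OF i]
  show "a \<oplus> i \<oplus> \<ominus> a \<in> ?Z"
    using a i Z(1,2) by (simp add: add.m_assoc)
  have "a \<otimes> i = i \<otimes> a"
    using a Z(3,4) by simp
  then show "a \<otimes> i \<otimes> inv a \<in> ?Z"
    using a i Z(1) by (simp add: m_assoc)
  have "brace_lambda B a i = i"
    using a Z(1,2,4) by (simp add: lambda_eq_iff)
  then show "brace_lambda B a i \<in> ?Z"
    using i by simp
qed

section \<open>Maximal ideals\<close>

lemma maximal_brace_idealD:
  assumes "maximal_brace_ideal M B"
  shows "brace_ideal M B" and "M \<noteq> carrier B"
    and "\<And>J. \<lbrakk>brace_ideal J B; M \<subseteq> J\<rbrakk> \<Longrightarrow> J = carrier B \<or> J = M"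
  using assms by (auto simp: maximal_brace_ideal_def)

lemma maximal_quot_simple:
  assumes M: "maximal_brace_ideal M B" and K: "brace_ideal K (brace_quot B M)"
  shows "K = {M} \<or> K = carrier (brace_quot B M)"
proof -
  note I = maximal_brace_idealD(1)[OF M]
  interpret Q: skew_brace "brace_quot B M" by (rule skew_brace_quot[OF I])
  interpret h: brace_morphism B "brace_quot B M" "\<lambda>a. M +> a" by (rule coset_morphism[OF I])
  let ?P = "{a \<in> carrier B. M +> a \<in> K}"
  have K0: "M \<in> K" and Ksub: "K \<subseteq> carrier (brace_quot B M)"
    using Q.brace_idealD(6,7)[OF K] by auto
  have sub: "M \<subseteq> ?P"
  proof
    fix a assume a: "a \<in> M"
    then have "a \<in> carrier B" using brace_idealD(6)[OF I] by auto
    moreover from this have "M +> a = M" using a coset_eq_ideal_iff[OF I] by simp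
    ultimately show "a \<in> ?P" using K0 by simp
  qed
  consider "?P = carrier B" | "?P = M"
    using maximal_brace_idealD(3)[OF M h.brace_ideal_preimage[OF K] sub] by blast
  then show ?thesis
  proof cases
    case 1
    then have "M +> a \<in> K" if "a \<in> carrier B" for a using that by blast
    then show ?thesis using Ksub by (auto simp: carrier_quot)
  next
    case 2
    have "X = M" if "X \<in> K" for X
    proof -
      have "X \<in> (\<lambda>a. M +> a) ` carrier B"
        using subsetD[OF Ksub that] by (simp only: carrier_quot)
      then obtain a where "a \<in> carrier B" "X = M +> a"
        by (elim imageE)
      moreover from this have "a \<in> ?P" using that by simp
      then have "a \<in> M" by (simp only: 2)
      ultimately show ?thesis using coset_eq_ideal_iff[OF I] by simp
    qed
    then show ?thesis using K0 by blast
  qed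
qed

lemma quot_carrier_nontrivial:
  assumes M: "maximal_brace_ideal M B"
  shows "carrier (brace_quot B M) \<noteq> {M}"
proof
  note I = maximal_brace_idealD(1)[OF M]
  assume "carrier (brace_quot B M) = {M}"
  then have "a \<in> M" if "a \<in> carrier B" for a
    using that by (auto simp: carrier_quot coset_eq_ideal_iff[OF I, symmetric])
  then show False
    using maximal_brace_idealD(2)[OF M] brace_idealD(6)[OF I] by blast
qed

lemma maximal_quot_Ann:
  assumes M: "maximal_brace_ideal M B" and nt: "\<not> trivial_brace (brace_quot B M)"
  shows "brace_Ann (brace_quot B M) = {M}"
proof -
  interpret Q: skew_brace "brace_quot B M"
    by (rule skew_brace_quot[OF maximal_brace_idealD(1)[OF M]])
  have "brace_Ann (brace_quot B M) \<noteq> carrier (brace_quot B M)"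
    using nt unfolding Q.trivial_brace_iff by (auto simp: Q.brace_Ann_eq)
  then show ?thesis
    using maximal_quot_simple[OF M Q.brace_ideal_Ann] by blast
qed

text \<open>The image of \<open>I\<close> is a non-zero ideal of the simple skew brace \<open>B/M\<close>; in other words, \<open>I + M = B\<close>.\<close>

lemma maximal_quot_covered:
  assumes M: "maximal_brace_ideal M B" and I: "brace_ideal I B" and sub: "\<not> I \<subseteq> M"
  shows "(\<lambda>a. M +> a) ` I = carrier (brace_quot B M)"
proof -
  note MI = maximal_brace_idealD(1)[OF M]
  interpret h: brace_morphism B "brace_quot B M" "\<lambda>a. M +> a" by (rule coset_morphism[OF MI])
  obtain i where i: "i \<in> I" "i \<notin> M"
    using sub by blast
  then have "M +> i \<noteq> M"
    using brace_idealD(6)[OF I] coset_eq_ideal_iff[OF MI, of i] by auto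
  then have "(\<lambda>a. M +> a) ` I \<noteq> {M}"
    using i(1) by blast
  moreover have "(\<lambda>a. M +> a) ` carrier B = carrier (brace_quot B M)"
    by (simp add: carrier_quot)
  ultimately show ?thesis
    using maximal_quot_simple[OF M h.brace_ideal_image[OF I]] by blast
qed

text \<open>Elements of \<open>I\<close> and \<open>J\<close> commute modulo \<open>I\<close> and modulo \<open>J\<close>, because one of them vanishes there.
  So they commute modulo \<open>I \<inter> J\<close>. If \<open>I \<inter> J \<subseteq> M\<close> while \<open>I\<close> and \<open>J\<close> both map onto \<open>B/M\<close>, then all elements of
  \<open>B/M\<close> commute: maximal ideals with non-trivial quotient behave like prime ideals.\<close>

lemma maximal_ideal_prime:
  assumes M: "maximal_brace_ideal M B" and nt: "\<not> trivial_brace (brace_quot B M)"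
    and I: "brace_ideal I B" "\<not> I \<subseteq> M" and J: "brace_ideal J B" "\<not> J \<subseteq> M"
  shows "\<not> I \<inter> J \<subseteq> M"
proof
  assume sub: "I \<inter> J \<subseteq> M"
  note MI = maximal_brace_idealD(1)[OF M]
  interpret Q: skew_brace "brace_quot B M" by (rule skew_brace_quot[OF MI])
  have "brace_commute (brace_quot B M) x y"
    if x: "x \<in> carrier (brace_quot B M)" and y: "y \<in> carrier (brace_quot B M)" for x y
  proof -
    have "x \<in> (\<lambda>a. M +> a) ` I" "y \<in> (\<lambda>a. M +> a) ` J"
      using x y maximal_quot_covered[OF M I] maximal_quot_covered[OF M J] by simp_all
    then obtain i j where i: "i \<in> I" "x = M +> i" and j: "j \<in> J" "y = M +> j"
      by (elim imageE)
    have ij: "i \<in> carrier B" "j \<in> carrier B"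
      using i(1) j(1) brace_idealD(6)[OF I(1)] brace_idealD(6)[OF J(1)] by blast+
    interpret QI: skew_brace "brace_quot B I" by (rule skew_brace_quot[OF I(1)])
    interpret QJ: skew_brace "brace_quot B J" by (rule skew_brace_quot[OF J(1)])
    have "I +> j \<in> carrier (brace_quot B I)" "J +> i \<in> carrier (brace_quot B J)"
      using ij by (simp_all add: carrier_quot)
    moreover have "I +> i = \<zero>\<^bsub>brace_quot B I\<^esub>" "J +> j = \<zero>\<^bsub>brace_quot B J\<^esub>"
      using i(1) j(1) coset_eq_ideal_iff[OF I(1) ij(1)] coset_eq_ideal_iff[OF J(1) ij(2)] by simp_all
    ultimately have "brace_commute (brace_quot B I) (I +> i) (I +> j)"
      "brace_commute (brace_quot B J) (J +> i) (J +> j)"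
      using QI.brace_commute_zero(2) QJ.brace_commute_zero(1) by metis+
    then have "brace_commute (brace_quot B M) (M +> i) (M +> j)"
      using sub ij by (simp add: brace_commute_quot_iff[OF I(1)] brace_commute_quot_iff[OF J(1)]
          brace_commute_quot_iff[OF MI] coset_eq_iff[OF I(1)] coset_eq_iff[OF J(1)]
          coset_eq_iff[OF MI] subset_iff)
    then show ?thesis
      using i(2) j(2) by simp
  qed
  then show False
    using nt Q.trivial_brace_iff by blast
qed

lemma maximal_ideal_prime_finite:
  assumes M: "maximal_brace_ideal M B" and nt: "\<not> trivial_brace (brace_quot B M)"
    and "finite S" and "\<And>I. I \<in> S \<Longrightarrow> brace_ideal I B" and "\<And>I. I \<in> S \<Longrightarrow> \<not> I \<subseteq> M"
  shows "\<not> carrier B \<inter> \<Inter> S \<subseteq> M"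
  using assms(3-5)
proof (induction S)
  case empty
  have "\<not> carrier B \<subseteq> M"
    using maximal_brace_idealD(2)[OF M] brace_idealD(6)[OF maximal_brace_idealD(1)[OF M]]
    by blast
  then show ?case by simp
next
  case (insert I S)
  have "\<not> I \<inter> (carrier B \<inter> \<Inter> S) \<subseteq> M"
  proof (rule maximal_ideal_prime[OF M nt])
    show "brace_ideal I B" "\<not> I \<subseteq> M" using insert.prems by simp_all
    show "brace_ideal (carrier B \<inter> \<Inter> S) B"
      by (rule brace_ideal_Inter) (simp add: insert.prems)
    show "\<not> carrier B \<inter> \<Inter> S \<subseteq> M"
      by (rule insert.IH) (simp_all add: insert.prems)
  qed
  then show ?case by (simp add: Int_left_commute)
qed

lemma maximal_ideals_incomparable:
  assumes "maximal_brace_ideal M B" "maximal_brace_ideal N B" "N \<noteq> M"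
  shows "\<not> N \<subseteq> M"
  using maximal_brace_idealD(3)[OF assms(2) maximal_brace_idealD(1)[OF assms(1)]]
    maximal_brace_idealD(2)[OF assms(1)] assms(3) by blast

end

section \<open>Maximal ideals with non-trivial quotient\<close>

definition nontrivial_maximal_ideals :: "('a, 'm) ring_scheme \<Rightarrow> 'a set set"
  where "nontrivial_maximal_ideals B = {I. maximal_brace_ideal I B \<and> \<not> trivial_brace (brace_quot B I)}"

context skew_brace
begin

lemma nontrivial_maximal_idealsD:
  assumes "M \<in> nontrivial_maximal_ideals B"
  shows "maximal_brace_ideal M B" "\<not> trivial_brace (brace_quot B M)" "brace_ideal M B"
    "M \<noteq> carrier B" "M \<subseteq> carrier B"
  using assms maximal_brace_idealD[of M] brace_idealD(6)[of M]
  by (auto simp: nontrivial_maximal_ideals_def)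

lemma coset_eq_of_mem:
  assumes "brace_ideal I B" "a \<in> carrier B" "b \<in> I"
  shows "I +> (a \<oplus> b) = I +> a" and "I +> (a \<otimes> b) = I +> a"
proof -
  interpret Q: skew_brace "brace_quot B I" by (rule skew_brace_quot[OF assms(1)])
  have b: "b \<in> carrier B" "I +> b = I"
    using assms brace_idealD(6)[of I] coset_eq_ideal_iff[of I b] by auto
  have a: "I +> a \<in> carrier (brace_quot B I)"
    using assms by (auto simp: carrier_quot)
  show "I +> (a \<oplus> b) = I +> a"
    using quot_add[OF assms(1,2) b(1)] Q.add.r_one[OF a] b(2) by simp
  show "I +> (a \<otimes> b) = I +> a"
    using quot_mult[OF assms(1,2) b(1)] Q.r_one[OF a] b(2) by simp
qed

lemma separating_element:
  assumes M: "M \<in> nontrivial_maximal_ideals B" and I: "brace_ideal I B" "\<not> I \<subseteq> M"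
    and c: "c \<in> carrier B"
  obtains e where "e \<in> I" "e \<in> carrier B" "M +> e = M +> c"
proof -
  have "M +> c \<in> (\<lambda>a. M +> a) ` I"
    using maximal_quot_covered[OF nontrivial_maximal_idealsD(1)[OF M] I] c by (simp add: carrier_quot)
  then show ?thesis
    using that brace_idealD(6)[OF I(1)] by force
qed

text \<open>For pairwise distinct ideals \<open>M\<close> in \<open>E\<close> there are elements \<open>e\<^sub>M\<close> that lie in all the other ideals and that
  agree modulo \<open>M\<close> with an element avoiding \<open>H\<close> modulo \<open>M\<close>. They lie in different cosets
  of \<open>H\<close>, so the number of cosets bounds the size of \<open>E\<close>. The lemma is needed for both groups of \<open>B\<close>, which
  is why it speaks of an unspecified group operation \<open>G\<close> on \<open>B\<close>.\<close>

lemma finite_maximal_ideals_of_finite_index: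
  assumes G: "carrier G = carrier B"
    and absorb: "\<And>M a b. \<lbrakk>M \<in> E; a \<in> carrier B; b \<in> M\<rbrakk> \<Longrightarrow> M +> (a \<otimes>\<^bsub>G\<^esub> b) = M +> a"
    and l_one: "\<And>a. a \<in> carrier B \<Longrightarrow> \<one>\<^bsub>G\<^esub> \<otimes>\<^bsub>G\<^esub> a = a"
    and H: "H \<subseteq> carrier B" "\<one>\<^bsub>G\<^esub> \<in> H" and fin: "finite (rcosets\<^bsub>G\<^esub> H)"
    and E: "E \<subseteq> nontrivial_maximal_ideals B"
    and avoid: "\<And>M. M \<in> E \<Longrightarrow> \<exists>c \<in> carrier B. \<forall>h \<in> H. M +> h \<noteq> M +> c"
  shows "finite E"
proof (rule ccontr)
  assume "infinite E"
  then obtain Y where Y: "finite Y" "Y \<subseteq> E" "card Y = Suc (card (rcosets\<^bsub>G\<^esub> H))"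
    using infinite_arbitrarily_large by metis
  have "\<exists>e \<in> carrier B. (\<forall>h \<in> H. M +> h \<noteq> M +> e) \<and> (\<forall>N \<in> Y - {M}. e \<in> N)" if M: "M \<in> Y" for M
  proof -
    have ME: "M \<in> E" "M \<in> nontrivial_maximal_ideals B"
      using M Y E by auto
    obtain c where c: "c \<in> carrier B" "\<forall>h \<in> H. M +> h \<noteq> M +> c"
      using avoid[OF ME(1)] by blast
    have N: "maximal_brace_ideal N B" if "N \<in> Y" for N
      using that Y E nontrivial_maximal_idealsD(1) by blast
    let ?I = "carrier B \<inter> \<Inter> (Y - {M})"
    have "brace_ideal ?I B"
      by (rule brace_ideal_Inter) (use N maximal_brace_idealD in blast)
    moreover have "\<not> ?I \<subseteq> M"
      by (rule maximal_ideal_prime_finite)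
        (use Y N M ME nontrivial_maximal_idealsD maximal_ideals_incomparable maximal_brace_idealD in auto)
    ultimately obtain e where "e \<in> ?I" "e \<in> carrier B" "M +> e = M +> c"
      using separating_element[OF ME(2)] c(1) by metis
    then show ?thesis using c(2) by (intro bexI[of _ e]) simp_all
  qed
  then obtain e where e: "\<And>M. M \<in> Y \<Longrightarrow> e M \<in> carrier B"
    "\<And>M h. \<lbrakk>M \<in> Y; h \<in> H\<rbrakk> \<Longrightarrow> M +> h \<noteq> M +> e M" "\<And>M N. \<lbrakk>M \<in> Y; N \<in> Y; N \<noteq> M\<rbrakk> \<Longrightarrow> e M \<in> N"
    by (metis Diff_iff singletonD)
  have "inj_on (\<lambda>M. H #>\<^bsub>G\<^esub> e M) Y"
  proof (rule inj_onI, rule ccontr)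
    fix M N assume MN: "M \<in> Y" "N \<in> Y" "H #>\<^bsub>G\<^esub> e M = H #>\<^bsub>G\<^esub> e N" "M \<noteq> N"
    have "\<one>\<^bsub>G\<^esub> \<otimes>\<^bsub>G\<^esub> e M \<in> H #>\<^bsub>G\<^esub> e M"
      using H(2) by (auto simp: r_coset_def)
    then have "e M \<in> H #>\<^bsub>G\<^esub> e N"
      using MN e(1) l_one by simp
    then obtain h where h: "h \<in> H" "e M = h \<otimes>\<^bsub>G\<^esub> e N"
      by (auto simp: r_coset_def)
    have "M +> e M = M +> h"
      using absorb[of M h "e N"] h MN e(3)[of N M] H(1) Y(2) by auto
    then show False
      using e(2)[of M h] MN h by simp
  qed
  moreover have "(\<lambda>M. H #>\<^bsub>G\<^esub> e M) ` Y \<subseteq> rcosets\<^bsub>G\<^esub> H"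
    using e(1) by (auto simp: RCOSETS_def G)
  ultimately have "card Y \<le> card (rcosets\<^bsub>G\<^esub> H)"
    using fin by (metis card_image card_mono)
  then show False using Y(3) by simp
qed

text \<open>If \<open>x\<close> is not in \<open>M\<close>, then its image is not in the annihilator of \<open>B/M\<close>, which is zero. So
  one of the two finite-index subgroups in property (s) maps to a proper subset of \<open>B/M\<close>. Each of them can do
  this for only finitely many \<open>M\<close>.\<close>

lemma finite_nontrivial_maximal_ideals_not_containing:
  assumes x: "x \<in> carrier B" and s: "property_s B x"
  shows "finite {M \<in> nontrivial_maximal_ideals B. x \<notin> M}"
proof -
  let ?E1 = "{M \<in> nontrivial_maximal_ideals B. \<exists>c \<in> carrier B.
    \<not> (M +> (x \<otimes> c) = M +> (x \<oplus> c) \<and> M +> (x \<oplus> c) = M +> (c \<oplus> x))}"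
  let ?E2 = "{M \<in> nontrivial_maximal_ideals B. \<exists>c \<in> carrier B.
    \<not> (M +> (c \<otimes> x) = M +> (c \<oplus> x) \<and> M +> (x \<otimes> c) = M +> (c \<otimes> x))}"
  let ?H1 = "Fix_r B x \<inter> centraliser (add_monoid B) x"
  let ?H2 = "Fix_l B x \<inter> centraliser B x"
  have H1: "?H1 \<subseteq> carrier B" "\<zero> \<in> ?H1"
    unfolding Fix_r_Int_centraliser[OF x] using x brace_commute_zero(1)[OF x]
    by (auto simp: brace_commute_def simp flip: zero_eq_one)
  have H2: "?H2 \<subseteq> carrier B" "\<one> \<in> ?H2"
    unfolding Fix_l_Int_centraliser[OF x] using x
    by (auto, metis add.l_one l_one zero_eq_one)
  have "{M \<in> nontrivial_maximal_ideals B. x \<notin> M} \<subseteq> ?E1 \<union> ?E2"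
  proof
    fix M assume "M \<in> {M \<in> nontrivial_maximal_ideals B. x \<notin> M}"
    then have M: "M \<in> nontrivial_maximal_ideals B" and xM: "x \<notin> M" by simp_all
    note I = nontrivial_maximal_idealsD[OF M]
    interpret Q: skew_brace "brace_quot B M" by (rule skew_brace_quot[OF I(3)])
    have "M +> x \<noteq> M"
      using x xM coset_eq_ideal_iff[OF I(3)] by simp
    then have "M +> x \<notin> brace_Ann (brace_quot B M)"
      using maximal_quot_Ann[OF I(1,2)] by simp
    then obtain c where c: "c \<in> carrier B" "\<not> brace_commute (brace_quot B M) (M +> x) (M +> c)"
      using x by (auto simp: Q.brace_Ann_eq carrier_quot)
    have "\<not> (M +> (x \<otimes> c) = M +> (x \<oplus> c) \<and> M +> (x \<oplus> c) = M +> (c \<oplus> x)) \<or>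
        \<not> (M +> (c \<otimes> x) = M +> (c \<oplus> x) \<and> M +> (x \<otimes> c) = M +> (c \<otimes> x))"
      using c(2) unfolding brace_commute_quot_iff[OF I(3) x c(1)] by metis
    then show "M \<in> ?E1 \<union> ?E2"
      using M c(1) by blast
  qed
  moreover have "finite ?E1"
  proof (rule finite_maximal_ideals_of_finite_index[where G = "add_monoid B" and H = ?H1])
    show "finite (rcosets\<^bsub>add_monoid B\<^esub> ?H1)"
      using s by (simp add: property_s_def)
    fix M assume "M \<in> ?E1"
    then obtain c where M: "M \<in> nontrivial_maximal_ideals B" and c: "c \<in> carrier B"
      "\<not> (M +> (x \<otimes> c) = M +> (x \<oplus> c) \<and> M +> (x \<oplus> c) = M +> (c \<oplus> x))"
      by blast
    note I = nontrivial_maximal_idealsD[OF M]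
    have "M +> h \<noteq> M +> c" if "h \<in> ?H1" for h
    proof
      assume eq: "M +> h = M +> c"
      have h: "h \<in> carrier B" "x \<otimes> h = x \<oplus> h" "x \<oplus> h = h \<oplus> x"
        using that x by (auto simp: Fix_r_Int_centraliser)
      show False
        using c h x eq by (metis quot_add[OF I(3)] quot_mult[OF I(3)])
    qed
    then show "\<exists>c \<in> carrier B. \<forall>h \<in> ?H1. M +> h \<noteq> M +> c"
      using c(1) by blast
  qed (use H1 in \<open>auto simp: coset_eq_of_mem nontrivial_maximal_idealsD\<close>)
  moreover have "finite ?E2"
  proof (rule finite_maximal_ideals_of_finite_index[where G = B and H = ?H2])
    show "finite (rcosets ?H2)"
      using s by (simp add: property_s_def)
    fix M assume "M \<in> ?E2"
    then obtain c where M: "M \<in> nontrivial_maximal_ideals B" and c: "c \<in> carrier B"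
      "\<not> (M +> (c \<otimes> x) = M +> (c \<oplus> x) \<and> M +> (x \<otimes> c) = M +> (c \<otimes> x))"
      by blast
    note I = nontrivial_maximal_idealsD[OF M]
    have "M +> h \<noteq> M +> c" if "h \<in> ?H2" for h
    proof
      assume eq: "M +> h = M +> c"
      have h: "h \<in> carrier B" "h \<otimes> x = h \<oplus> x" "x \<otimes> h = h \<otimes> x"
        using that x by (auto simp: Fix_l_Int_centraliser)
      show False
        using c h x eq by (metis quot_add[OF I(3)] quot_mult[OF I(3)])
    qed
    then show "\<exists>c \<in> carrier B. \<forall>h \<in> ?H2. M +> h \<noteq> M +> c"
      using c(1) by blast
  qed (use H2 in \<open>auto simp: coset_eq_of_mem nontrivial_maximal_idealsD\<close>)
  ultimately show ?thesis
    using finite_subset by blast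
qed

text \<open>Pick \<open>x\<close> outside \<open>M\<close>. The ideals of the family that contain \<open>x\<close> may be infinitely many, but their
  intersection is not below \<open>M\<close>, because of \<open>x\<close>. The remaining ones are finitely many, so primality of
  \<open>M\<close> applies to them.\<close>

lemma Inter_other_maximal_ideals:
  assumes S: "property_S B" and M: "M \<in> nontrivial_maximal_ideals B"
  shows "\<not> carrier B \<inter> \<Inter> (nontrivial_maximal_ideals B - {M}) \<subseteq> M"
proof -
  let ?N = "nontrivial_maximal_ideals B"
  note MD = nontrivial_maximal_idealsD[OF M]
  obtain x where x: "x \<in> carrier B" "x \<notin> M"
    using MD by blast
  let ?F = "{N \<in> ?N. x \<notin> N}"
  let ?I = "carrier B \<inter> \<Inter> (?N - ?F)" and ?J = "carrier B \<inter> \<Inter> (?F - {M})"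
  have fin: "finite ?F"
    using finite_nontrivial_maximal_ideals_not_containing x S by (simp add: property_S_def)
  have "\<not> ?I \<inter> ?J \<subseteq> M"
  proof (rule maximal_ideal_prime[OF MD(1,2)])
    show "brace_ideal ?I B" "brace_ideal ?J B"
      by (rule brace_ideal_Inter; use nontrivial_maximal_idealsD in blast)+
    show "\<not> ?I \<subseteq> M" using x by blast
    show "\<not> ?J \<subseteq> M"
      by (rule maximal_ideal_prime_finite[OF MD(1,2)])
        (use fin MD nontrivial_maximal_idealsD maximal_ideals_incomparable in auto)
  qed
  moreover have "?I \<inter> ?J \<subseteq> carrier B \<inter> \<Inter> (?N - {M})"
    by blast
  ultimately show ?thesis by blast
qed

text \<open>Prescribing one more residue, modulo \<open>M\<close>, is done by adding an element that lies in all
  other ideals of the family, finitely many or not. This leaves the residues already prescribed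
  unchanged. It is what makes the map into the restricted product surjective.\<close>

lemma finite_strong_approximation:
  assumes S: "property_S B" and "finite F" and "F \<subseteq> nontrivial_maximal_ideals B"
    and "\<And>M. M \<in> F \<Longrightarrow> x M \<in> carrier (brace_quot B M)"
  shows "\<exists>b \<in> carrier B. (\<forall>M \<in> F. M +> b = x M) \<and> (\<forall>M \<in> nontrivial_maximal_ideals B - F. b \<in> M)"
  using assms(2-)
proof (induction F)
  case empty
  show ?case
    by (rule bexI[of _ \<zero>]) (auto dest: nontrivial_maximal_idealsD(3) intro: brace_idealD(7))
next
  case (insert M F)
  let ?N = "nontrivial_maximal_ideals B"
  have M: "M \<in> ?N" using insert by simp
  note MD = nontrivial_maximal_idealsD[OF M]
  have "\<exists>b \<in> carrier B. (\<forall>M \<in> F. M +> b = x M) \<and> (\<forall>M \<in> ?N - F. b \<in> M)"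
    by (rule insert.IH) (use insert.prems in auto)
  then obtain b where b: "b \<in> carrier B" "\<And>N. N \<in> F \<Longrightarrow> N +> b = x N"
    "\<And>N. \<lbrakk>N \<in> ?N; N \<notin> F\<rbrakk> \<Longrightarrow> b \<in> N"
    by blast
  let ?I = "carrier B \<inter> \<Inter> (?N - {M})"
  obtain c where c: "c \<in> carrier B" "x M = M +> c"
    using insert.prems(2)[of M] by (auto simp: carrier_quot)
  have "brace_ideal ?I B"
    by (rule brace_ideal_Inter) (use nontrivial_maximal_idealsD in blast)
  then obtain e where e: "e \<in> ?I" "e \<in> carrier B" "M +> e = M +> c"
    using separating_element[OF M _ Inter_other_maximal_ideals[OF S M] c(1)] by metis
  show ?case
  proof (rule bexI[of _ "e \<oplus> b"], intro conjI ballI)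
    fix N assume N: "N \<in> insert M F"
    show "N +> (e \<oplus> b) = x N"
    proof (cases "N = M")
      case True
      then show ?thesis
        using coset_eq_of_mem(1)[OF MD(3) e(2), of b] b(3)[OF M] insert.hyps e c by simp
    next
      case False
      then have NN: "N \<in> ?N" "e \<in> N"
        using N insert.prems e(1) by auto
      note I = nontrivial_maximal_idealsD(3)[OF NN(1)]
      interpret Q: skew_brace "brace_quot B N" by (rule skew_brace_quot[OF I])
      have "N +> e = N"
        using coset_eq_ideal_iff[OF I e(2)] NN by simp
      moreover have "N +> b \<in> carrier (brace_quot B N)"
        using b(1) by (auto simp: carrier_quot)
      ultimately have "N +> (e \<oplus> b) = N +> b"
        using quot_add[OF I e(2) b(1)] Q.add.l_one[of "N +> b"] by simp
      then show ?thesis using b(2) N False by simp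
    qed
  next
    fix N assume N: "N \<in> ?N - insert M F"
    then have "e \<in> N" "b \<in> N" "brace_ideal N B"
      using e b nontrivial_maximal_idealsD by auto
    then show "e \<oplus> b \<in> N"
      using subgroup.m_closed[OF brace_idealD(1), of N e b] by simp
  qed (use e b in simp)
qed

end

section \<open>Simple trivial braces\<close>

text \<open>A non-trivial element \<open>x\<close> generates the group. Let \<open>p\<close> be a prime factor of its order \<open>n\<close>, where \<open>n = 0\<close>
  stands for infinite order. If \<open>x\<^sup>p\<close> generates the group too, then \<open>x\<close> is a power of \<open>x\<^sup>p\<close>, so \<open>n\<close>, and hence
  \<open>p\<close>, divides a number of the form \<open>p k - 1\<close>, which is impossible. Hence \<open>x\<^sup>p\<close> is trivial and \<open>n = p\<close>.\<close>

lemma (in group) prime_order_of_no_subgroups: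
  assumes nt: "carrier G \<noteq> {\<one>}" and sub: "\<And>H. subgroup H G \<Longrightarrow> H = {\<one>} \<or> H = carrier G"
  shows "prime (order G)"
proof -
  obtain x where x: "x \<in> carrier G" "x \<noteq> \<one>"
    using nt one_closed by blast
  have gen: "generate G {y} = {\<one>} \<or> generate G {y} = carrier G" if "y \<in> carrier G" for y
    using that by (intro sub generate_is_subgroup) simp
  have "x \<in> generate G {x}"
    by (rule generate.incl) simp
  then have genx: "generate G {x} = carrier G"
    using gen[OF x(1)] x(2) by auto
  have n1: "ord x \<noteq> 1"
    using x ord_eq_1 by simp
  then obtain p where p: "prime p" "p dvd ord x"
    using prime_factor_nat by blast
  have "generate G {x [^] p} \<noteq> carrier G"
  proof
    assume "generate G {x [^] p} = carrier G"
    then have "x \<in> generate G {x [^] p}" using x by simp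
    then obtain k :: int where "x = (x [^] p) [^] k"
      using generate_pow[of "x [^] p"] x by auto
    then have "x [^] (1::int) = x [^] (int p * k)"
      using x by (simp add: int_pow_pow flip: int_pow_int)
    then have "int (ord x) dvd 1 - int p * k"
      using x int_pow_eq[of x 1 "int p * k"] by (simp add: dvd_diff_commute)
    then have "int p dvd 1 - int p * k"
      using p(2) by (meson dvd_trans int_dvd_int_iff)
    then have "int p dvd 1"
      by (metis dvd_add_right_iff diff_add_cancel dvd_triv_left add.commute)
    then show False using p(1) by (simp add: prime_nat_iff)
  qed
  then have "generate G {x [^] p} = {\<one>}"
    using gen x by auto
  then have "x [^] p = \<one>"
    using generate.incl[of "x [^] p" "{x [^] p}" G] by auto
  then have "ord x dvd p"
    using x pow_eq_id by simp
  then have "prime (ord x)"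
    using p n1 by (metis prime_nat_iff)
  then show ?thesis
    using generate_pow_card[OF x(1)] genx by (simp add: order_def)
qed

text \<open>In a trivial brace every subgroup is an ideal, so \<open>B/M\<close> has no proper non-trivial subgroups.\<close>

lemma (in skew_brace) trivial_maximal_quot_prime_order:
  assumes M: "maximal_brace_ideal M B" and triv: "trivial_brace (brace_quot B M)"
  shows "prime (order (brace_quot B M))"
proof -
  interpret Q: trivial_brace "brace_quot B M" by fact
  interpret QA: comm_group "add_monoid (brace_quot B M)" by (rule Q.add_comm_group)
  have "brace_ideal K (brace_quot B M)" if K: "subgroup K (brace_quot B M)" for K
  proof -
    have sub: "k \<in> carrier (brace_quot B M)" if "k \<in> K" for k
      using that subgroup.subset[OF K] by auto
    have comm: "a \<oplus>\<^bsub>brace_quot B M\<^esub> b = b \<oplus>\<^bsub>brace_quot B M\<^esub> a"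
      if "a \<in> carrier (brace_quot B M)" "b \<in> carrier (brace_quot B M)" for a b
      using QA.m_comm that by simp
    have inv: "inv\<^bsub>brace_quot B M\<^esub> a = \<ominus>\<^bsub>brace_quot B M\<^esub> a" if "a \<in> carrier (brace_quot B M)" for a
      using that Q.zero_eq_one by (intro Q.inv_equality) (simp_all add: Q.circ_eq_add)
    have conj: "a \<oplus>\<^bsub>brace_quot B M\<^esub> k \<oplus>\<^bsub>brace_quot B M\<^esub> \<ominus>\<^bsub>brace_quot B M\<^esub> a = k"
      if "a \<in> carrier (brace_quot B M)" "k \<in> K" for a k
      using that sub comm[of a k] by (simp add: Q.add.m_assoc del: quot_simps)
    show ?thesis
    proof (rule Q.brace_idealI[OF _ K])
      show "subgroup K (add_monoid (brace_quot B M))"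
        using subgroup.m_closed[OF K] subgroup.m_inv_closed[OF K] subgroup.one_closed[OF K] sub
        by (intro Q.add.subgroupI) (auto simp: Q.circ_eq_add inv)
    qed (use conj sub in \<open>auto simp: Q.circ_eq_add inv brace_lambda_def simp del: quot_simps\<close>)
  qed
  then show ?thesis
    using maximal_quot_simple[OF M] quot_carrier_nontrivial[OF M]
    by (intro Q.prime_order_of_no_subgroups) auto
qed

section \<open>Products\<close>

lemma brace_prod_simps [simp]:
  "carrier (brace_prod I F) = (\<Pi>\<^sub>E i\<in>I. carrier (F i))"
  "x \<otimes>\<^bsub>brace_prod I F\<^esub> y = (\<lambda>i\<in>I. x i \<otimes>\<^bsub>F i\<^esub> y i)"
  "x \<oplus>\<^bsub>brace_prod I F\<^esub> y = (\<lambda>i\<in>I. x i \<oplus>\<^bsub>F i\<^esub> y i)"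
  "\<one>\<^bsub>brace_prod I F\<^esub> = (\<lambda>i\<in>I. \<one>\<^bsub>F i\<^esub>)"
  "\<zero>\<^bsub>brace_prod I F\<^esub> = (\<lambda>i\<in>I. \<zero>\<^bsub>F i\<^esub>)"
  by (simp_all add: brace_prod_def monoid.defs)

lemma restricted_brace_prod_simps [simp]:
  "carrier (restricted_brace_prod I F) = {x \<in> \<Pi>\<^sub>E i\<in>I. carrier (F i). finite {i \<in> I. x i \<noteq> \<zero>\<^bsub>F i\<^esub>}}"
  "x \<otimes>\<^bsub>restricted_brace_prod I F\<^esub> y = (\<lambda>i\<in>I. x i \<otimes>\<^bsub>F i\<^esub> y i)"
  "x \<oplus>\<^bsub>restricted_brace_prod I F\<^esub> y = (\<lambda>i\<in>I. x i \<oplus>\<^bsub>F i\<^esub> y i)"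
  by (simp_all add: restricted_brace_prod_def)

lemma add_monoid_brace_prod: "add_monoid (brace_prod I F) = product_group I (\<lambda>i. add_monoid (F i))"
  by (simp add: brace_prod_def product_group_def monoid.defs)

text \<open>When the two operations agree and are commutative, brace distributivity reads
  \<open>a + (b + c) = (a + b - a) + (a + c)\<close>, which is an identity of abelian groups.\<close>

lemma trivial_braceI:
  assumes comm: "comm_group (add_monoid P)" and one: "\<one>\<^bsub>P\<^esub> = \<zero>\<^bsub>P\<^esub>"
    and mult: "\<And>a b. \<lbrakk>a \<in> carrier P; b \<in> carrier P\<rbrakk> \<Longrightarrow> a \<otimes>\<^bsub>P\<^esub> b = a \<oplus>\<^bsub>P\<^esub> b"
  shows "trivial_brace P"
proof -
  interpret A: comm_group "add_monoid P" by (rule comm)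
  have inv: "inv\<^bsub>add_monoid P\<^esub> a = \<ominus>\<^bsub>P\<^esub> a" for a
    by (simp add: a_inv_def)
  have grp: "group P"
  proof (rule groupI)
    fix x assume "x \<in> carrier P"
    then show "\<exists>y \<in> carrier P. y \<otimes>\<^bsub>P\<^esub> x = \<one>\<^bsub>P\<^esub>"
      using A.inv_closed[of x] A.l_inv[of x] by (auto simp: mult one)
  qed (use A.m_closed A.m_assoc A.l_one A.one_closed in \<open>simp_all add: mult one\<close>)
  have "a \<otimes>\<^bsub>P\<^esub> (b \<oplus>\<^bsub>P\<^esub> c) = (a \<otimes>\<^bsub>P\<^esub> b \<ominus>\<^bsub>P\<^esub> a) \<oplus>\<^bsub>P\<^esub> (a \<otimes>\<^bsub>P\<^esub> c)"
    if abc: "a \<in> carrier P" "b \<in> carrier P" "c \<in> carrier P" for a b c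
  proof -
    have na: "\<ominus>\<^bsub>P\<^esub> a \<in> carrier P"
      using A.inv_closed[of a] abc by (simp add: inv)
    have "a \<oplus>\<^bsub>P\<^esub> b \<ominus>\<^bsub>P\<^esub> a = b"
      using abc na A.m_comm[of a b] A.m_assoc[of b a "\<ominus>\<^bsub>P\<^esub> a"] A.r_inv[of a] A.r_one[of b]
      by (simp add: a_minus_def inv)
    then show ?thesis
      using abc A.m_closed[of b c] A.m_lcomm[of a b c] by (simp add: mult)
  qed
  then have "skew_brace P"
    by (intro skew_brace.intro grp A.group_axioms)
  then show ?thesis
    by (intro trivial_brace.intro trivial_brace_axioms.intro comm mult)
qed

lemma trivial_brace_prod:
  assumes "\<And>i. i \<in> I \<Longrightarrow> trivial_brace (F i)"
  shows "trivial_brace (brace_prod I F)"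
proof (rule trivial_braceI)
  have comm: "comm_group (add_monoid (F i))" if "i \<in> I" for i
    using assms[OF that] by (simp add: trivial_brace_def trivial_brace_axioms_def)
  have circ: "a \<otimes>\<^bsub>F i\<^esub> b = a \<oplus>\<^bsub>F i\<^esub> b"
    if "i \<in> I" "a \<in> carrier (F i)" "b \<in> carrier (F i)" for i a b
    using assms[OF that(1)] that by (simp add: trivial_brace_def trivial_brace_axioms_def)
  have m_comm: "a \<oplus>\<^bsub>F i\<^esub> b = b \<oplus>\<^bsub>F i\<^esub> a"
    if "i \<in> I" "a \<in> carrier (F i)" "b \<in> carrier (F i)" for i a b
    using comm_monoid.m_comm[of "add_monoid (F i)" a b] comm[OF that(1)] that
    by (simp add: comm_group_def)
  show "comm_group (add_monoid (brace_prod I F))"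
    unfolding add_monoid_brace_prod
    by (rule group.group_comm_groupI)
      (use comm m_comm in \<open>auto simp: comm_group_def PiE_iff intro!: restrict_ext\<close>)
  show "\<one>\<^bsub>brace_prod I F\<^esub> = \<zero>\<^bsub>brace_prod I F\<^esub>"
    using assms by (auto simp: trivial_brace_def skew_brace.zero_eq_one intro!: restrict_ext)
  show "a \<otimes>\<^bsub>brace_prod I F\<^esub> b = a \<oplus>\<^bsub>brace_prod I F\<^esub> b"
    if "a \<in> carrier (brace_prod I F)" "b \<in> carrier (brace_prod I F)" for a b
    using that circ by (auto simp: PiE_iff intro!: restrict_ext)
qed

lemma brace_hom_pair:
  assumes "f \<in> brace_hom B P" "g \<in> brace_hom B Q"
  shows "(\<lambda>b. (f b, g b)) \<in> brace_hom B (RDirProd P Q)"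
  using assms by (auto simp: brace_hom_def hom_def RDirProd_carrier Pi_iff)
    (auto simp: RDirProd_def monoid.defs DirProd_def)

context skew_brace
begin

lemma coset_tuple_hom:
  assumes "\<And>M. M \<in> S \<Longrightarrow> brace_ideal M B"
  shows "(\<lambda>b. \<lambda>M\<in>S. M +> b) \<in> brace_hom B (brace_prod S (brace_quot B))"
  using assms by (auto simp: brace_hom_def hom_def carrier_quot quot_add quot_mult intro!: restrict_ext)

lemma coset_tuple_eq_iff:
  "(\<lambda>M\<in>S. M +> a) = (\<lambda>M\<in>S. M +> b) \<longleftrightarrow> (\<forall>M\<in>S. M +> a = M +> b)"
  by (auto simp: restrict_def fun_eq_iff)

section \<open>The quotient by the radical\<close>

lemma coset_tuple_hom_nontrivial_simple_image_prod:
  assumes S: "property_S B"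
  defines "\<phi> \<equiv> (\<lambda>b. \<lambda>M\<in>nontrivial_maximal_ideals B. M +> b)"
  shows "\<phi> \<in> brace_hom B (nontrivial_simple_image_prod B)"
    and "\<phi> ` carrier B = carrier (nontrivial_simple_image_prod B)"
proof -
  let ?N = "nontrivial_maximal_ideals B" and ?C = "nontrivial_simple_image_prod B"
  note I = nontrivial_maximal_idealsD(3)
  have C: "?C = restricted_brace_prod ?N (brace_quot B)"
    by (simp add: nontrivial_simple_image_prod_def nontrivial_maximal_ideals_def)
  have closed: "\<phi> b \<in> carrier ?C" if b: "b \<in> carrier B" for b
  proof -
    have "{M \<in> ?N. \<phi> b M \<noteq> \<zero>\<^bsub>brace_quot B M\<^esub>} = {M \<in> ?N. b \<notin> M}"
      using coset_eq_ideal_iff[OF I b] by (auto simp: \<phi>_def)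
    moreover have "finite {M \<in> ?N. b \<notin> M}"
      using finite_nontrivial_maximal_ideals_not_containing[OF b] S b by (simp add: property_S_def)
    ultimately have "finite {M \<in> ?N. \<phi> b M \<noteq> \<zero>\<^bsub>brace_quot B M\<^esub>}"
      by (simp only:)
    moreover have "\<phi> b \<in> (\<Pi>\<^sub>E M\<in>?N. carrier (brace_quot B M))"
      using b by (auto simp: \<phi>_def carrier_quot)
    ultimately show ?thesis by (simp add: C)
  qed
  then show "\<phi> \<in> brace_hom B ?C"
    using coset_tuple_hom[OF I, of ?N] by (auto simp: brace_hom_def hom_def C \<phi>_def)
  have "x \<in> \<phi> ` carrier B" if x: "x \<in> carrier ?C" for x
  proof -
    \<comment> \<open>The approximation lemma controls a preimage of \<open>x\<close> also at the infinitely many places where \<open>x\<close> vanishes.\<close>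
    let ?F = "{M \<in> ?N. x M \<noteq> \<zero>\<^bsub>brace_quot B M\<^esub>}"
    have xE: "x \<in> (\<Pi>\<^sub>E M\<in>?N. carrier (brace_quot B M))" and fin: "finite ?F"
      using x by (simp_all only: C restricted_brace_prod_simps mem_Collect_eq)
    have "\<exists>b \<in> carrier B. (\<forall>M \<in> ?F. M +> b = x M) \<and> (\<forall>M \<in> ?N - ?F. b \<in> M)"
      by (rule finite_strong_approximation[OF S fin]) (use xE in \<open>auto dest: PiE_mem\<close>)
    then obtain b where b: "b \<in> carrier B" "\<And>M. M \<in> ?F \<Longrightarrow> M +> b = x M"
      "\<And>M. \<lbrakk>M \<in> ?N; M \<notin> ?F\<rbrakk> \<Longrightarrow> b \<in> M"
      by blast
    have "M +> b = x M" if M: "M \<in> ?N" for M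
    proof (cases "M \<in> ?F")
      case False
      then have "M +> b = M" "x M = M"
        using b(3)[OF M False] coset_eq_ideal_iff[OF I[OF M] b(1)] M by simp_all
      then show ?thesis by simp
    qed (rule b(2))
    then have "x = \<phi> b"
      using xE by (intro PiE_ext[where k = ?N]) (auto simp: \<phi>_def carrier_quot b(1))
    then show ?thesis using b(1) by blast
  qed
  then show "\<phi> ` carrier B = carrier ?C"
    using closed by blast
qed

lemma brace_ideal_Rad: "brace_ideal (brace_Rad B) B"
  unfolding brace_Rad_def by (rule brace_ideal_Inter) (simp add: maximal_brace_ideal_def)

text \<open>Since \<open>R\<close> is an intersection, commuting modulo \<open>R\<close> is commuting modulo every maximal \<open>M\<close>. The simple skew
  brace \<open>B/M\<close> is its own annihilator when it is trivial, and has zero annihilator otherwise.\<close>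

lemma Ann_quot_Rad_iff:
  assumes a: "a \<in> carrier B"
  shows "brace_Rad B +> a \<in> brace_Ann (brace_quot B (brace_Rad B)) \<longleftrightarrow>
    a \<in> carrier B \<inter> \<Inter> (nontrivial_maximal_ideals B)"
proof -
  let ?R = "brace_Rad B" and ?Max = "{M. maximal_brace_ideal M B}"
  interpret QR: skew_brace "brace_quot B ?R" by (rule skew_brace_quot[OF brace_ideal_Rad])
  have MaxI: "\<And>M. M \<in> ?Max \<Longrightarrow> brace_ideal M B"
    by (simp add: maximal_brace_ideal_def)
  have "?R +> a \<in> brace_Ann (brace_quot B ?R) \<longleftrightarrow>
      (\<forall>b \<in> carrier B. brace_commute (brace_quot B ?R) (?R +> a) (?R +> b))"
    using a by (auto simp: QR.brace_Ann_eq carrier_quot)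
  also have "\<dots> \<longleftrightarrow> (\<forall>b \<in> carrier B. \<forall>M \<in> ?Max. brace_commute (brace_quot B M) (M +> a) (M +> b))"
    unfolding brace_Rad_def using brace_commute_quot_Inter[OF MaxI a] by blast
  also have "\<dots> \<longleftrightarrow> (\<forall>M \<in> ?Max. M +> a \<in> brace_Ann (brace_quot B M))"
  proof -
    have "M +> a \<in> brace_Ann (brace_quot B M) \<longleftrightarrow>
        (\<forall>b \<in> carrier B. brace_commute (brace_quot B M) (M +> a) (M +> b))" if "M \<in> ?Max" for M
      using a skew_brace.brace_Ann_eq[OF skew_brace_quot[OF MaxI[OF that]]] by (auto simp: carrier_quot)
    then show ?thesis by blast
  qed
  also have "\<dots> \<longleftrightarrow> (\<forall>M \<in> nontrivial_maximal_ideals B. a \<in> M)"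
  proof -
    have "M +> a \<in> brace_Ann (brace_quot B M) \<longleftrightarrow> M \<in> nontrivial_maximal_ideals B \<longrightarrow> a \<in> M"
      if M: "M \<in> ?Max" for M
    proof (cases "trivial_brace (brace_quot B M)")
      case True
      interpret Q: skew_brace "brace_quot B M" by (rule skew_brace_quot[OF MaxI[OF M]])
      have "M +> a \<in> brace_Ann (brace_quot B M)"
        using True a unfolding Q.trivial_brace_iff by (auto simp: Q.brace_Ann_eq carrier_quot)
      then show ?thesis
        using True by (simp add: nontrivial_maximal_ideals_def)
    next
      case False
      then show ?thesis
        using M maximal_quot_Ann[of M] coset_eq_ideal_iff[OF MaxI[OF M] a]
        by (simp add: nontrivial_maximal_ideals_def)
    qed
    then show ?thesis by (auto simp: nontrivial_maximal_ideals_def)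
  qed
  finally show ?thesis using a by simp
qed

text \<open>An ideal containing \<open>R\<close> is the union of its cosets of \<open>R\<close>, hence determined by its image in \<open>B/R\<close>.\<close>

lemma is_Ann_preimage_Rad_iff:
  "is_Ann_preimage A (brace_Rad B) B \<longleftrightarrow> A = carrier B \<inter> \<Inter> (nontrivial_maximal_ideals B)"
proof -
  let ?R = "brace_Rad B" and ?A = "carrier B \<inter> \<Inter> (nontrivial_maximal_ideals B)"
  let ?Ann = "brace_Ann (brace_quot B ?R)"
  have ideal: "brace_ideal ?A B"
    by (rule brace_ideal_Inter) (rule nontrivial_maximal_idealsD(3))
  have sub: "?R \<subseteq> ?A"
    by (auto simp: brace_Rad_def nontrivial_maximal_ideals_def)
  have Ann: "?Ann = (\<lambda>a. ?R +> a) ` ?A"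
  proof
    show "(\<lambda>a. ?R +> a) ` ?A \<subseteq> ?Ann"
      using Ann_quot_Rad_iff by blast
    show "?Ann \<subseteq> (\<lambda>a. ?R +> a) ` ?A"
    proof
      fix X assume X: "X \<in> ?Ann"
      then have "X \<in> carrier (brace_quot B ?R)"
        by (simp add: brace_Ann_def)
      then obtain a where "a \<in> carrier B" "X = ?R +> a"
        unfolding carrier_quot by (elim imageE)
      with X show "X \<in> (\<lambda>a. ?R +> a) ` ?A"
        using Ann_quot_Rad_iff by blast
    qed
  qed
  show ?thesis
  proof
    assume "is_Ann_preimage A ?R B"
    then have A: "brace_ideal A B" "?R \<subseteq> A" "(\<lambda>a. ?R +> a) ` A = ?Ann"
      by (simp_all add: is_Ann_preimage_def)
    show "A = ?A"
    proof
      show "A \<subseteq> ?A"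
      proof
        fix a assume a: "a \<in> A"
        then have "?R +> a \<in> ?Ann" "a \<in> carrier B"
          using A(3) brace_idealD(6)[OF A(1)] by blast+
        then show "a \<in> ?A" using Ann_quot_Rad_iff by blast
      qed
      show "?A \<subseteq> A"
      proof
        fix a assume a: "a \<in> ?A"
        then have "?R +> a \<in> (\<lambda>a. ?R +> a) ` A"
          using Ann A(3) by blast
        then obtain b where b: "b \<in> A" "?R +> a = ?R +> b"
          by (elim imageE)
        have ab: "a \<in> carrier B" "b \<in> carrier B"
          using a b(1) brace_idealD(6)[OF A(1)] by blast+
        then have "a \<ominus> b \<in> A"
          using b(2) A(2) coset_eq_iff[OF brace_ideal_Rad] by blast
        then have "a \<ominus> b \<oplus> b \<in> A"
          using subgroup.m_closed[OF brace_idealD(1)[OF A(1)], of "a \<ominus> b" b] b(1) by simp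
        then show "a \<in> A"
          using ab by (simp add: a_minus_def add.m_assoc)
      qed
    qed
  next
    assume "A = ?A"
    then show "is_Ann_preimage A ?R B"
      using ideal sub Ann by (simp add: is_Ann_preimage_def)
  qed
qed

end

theorem theorem3p40:
  fixes B :: "('a, 'm) ring_scheme"
  assumes "skew_brace B"
    and "property_S B"
  shows "(\<exists>(J :: 'a set set) (T :: 'a set \<Rightarrow> 'a set ring).
            (\<forall>j \<in> J. trivial_brace (T j) \<and> prime (order (T j))) \<and>
            trivial_brace (brace_prod J T) \<and>
            brace_embeds (brace_quot B (brace_Rad B))
              (RDirProd (nontrivial_simple_image_prod B) (brace_prod J T))) \<and>
         (\<exists>!A. is_Ann_preimage A (brace_Rad B) B) \<and>
         (\<forall>A. is_Ann_preimage A (brace_Rad B) B \<longrightarrow>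
            brace_isomorphic (brace_quot B A) (nontrivial_simple_image_prod B))"
proof (intro conjI allI impI)
  interpret skew_brace B by fact
  let ?N = "nontrivial_maximal_ideals B" and ?C = "nontrivial_simple_image_prod B"
  let ?A = "carrier B \<inter> \<Inter> ?N" and ?R = "brace_Rad B"
  define J where "J = {M. maximal_brace_ideal M B \<and> trivial_brace (brace_quot B M)}"
  let ?\<phi> = "\<lambda>b. \<lambda>M\<in>?N. M +>\<^bsub>B\<^esub> b" and ?\<psi> = "\<lambda>b. \<lambda>M\<in>J. M +>\<^bsub>B\<^esub> b"
  note \<phi> = coset_tuple_hom_nontrivial_simple_image_prod[OF assms(2)]
  have NI: "\<And>M. M \<in> ?N \<Longrightarrow> brace_ideal M B" and JI: "\<And>M. M \<in> J \<Longrightarrow> brace_ideal M B"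
    by (auto simp: nontrivial_maximal_ideals_def J_def maximal_brace_ideal_def)

  have JD: "\<forall>M \<in> J. trivial_brace (brace_quot B M) \<and> prime (order (brace_quot B M))"
    using trivial_maximal_quot_prime_order by (simp add: J_def)
  moreover have "trivial_brace (brace_prod J (brace_quot B))"
    using JD by (intro trivial_brace_prod) simp
  moreover have "brace_embeds (brace_quot B ?R) (RDirProd ?C (brace_prod J (brace_quot B)))"
  proof (rule brace_embeds_quotI[OF brace_ideal_Rad])
    show "(\<lambda>b. (?\<phi> b, ?\<psi> b)) \<in> brace_hom B (RDirProd ?C (brace_prod J (brace_quot B)))"
      by (rule brace_hom_pair[OF \<phi>(1)], rule coset_tuple_hom, rule JI)
    fix a b assume ab: "a \<in> carrier B" "b \<in> carrier B"
    have "{M. maximal_brace_ideal M B} = ?N \<union> J"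
      by (auto simp: nontrivial_maximal_ideals_def J_def)
    then have "?R +>\<^bsub>B\<^esub> a = ?R +>\<^bsub>B\<^esub> b \<longleftrightarrow> (\<forall>M \<in> ?N \<union> J. M +>\<^bsub>B\<^esub> a = M +>\<^bsub>B\<^esub> b)"
      unfolding brace_Rad_def by (simp only:) (rule coset_Inter_eq_iff; use NI JI ab in blast)
    then show "(?\<phi> a, ?\<psi> a) = (?\<phi> b, ?\<psi> b) \<longleftrightarrow> ?R +>\<^bsub>B\<^esub> a = ?R +>\<^bsub>B\<^esub> b"
      unfolding prod.inject coset_tuple_eq_iff by blast
  qed
  ultimately show "\<exists>(J :: 'a set set) (T :: 'a set \<Rightarrow> 'a set ring).
      (\<forall>j \<in> J. trivial_brace (T j) \<and> prime (order (T j))) \<and>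
      trivial_brace (brace_prod J T) \<and>
      brace_embeds (brace_quot B ?R) (RDirProd ?C (brace_prod J T))"
    by blast

  show "\<exists>!A. is_Ann_preimage A ?R B"
    by (simp add: is_Ann_preimage_Rad_iff)

  fix A assume "is_Ann_preimage A ?R B"
  then have A: "A = ?A"
    by (simp only: is_Ann_preimage_Rad_iff)
  show "brace_isomorphic (brace_quot B A) ?C"
    unfolding A
  proof (rule brace_isomorphic_quotI[OF _ \<phi>(1) _ \<phi>(2)])
    show "brace_ideal ?A B"
      by (rule brace_ideal_Inter) (rule NI)
    show "?\<phi> a = ?\<phi> b \<longleftrightarrow> ?A +>\<^bsub>B\<^esub> a = ?A +>\<^bsub>B\<^esub> b"
      if "a \<in> carrier B" "b \<in> carrier B" for a b
      unfolding coset_tuple_eq_iff by (rule coset_Inter_eq_iff[symmetric]; use NI that in blast)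
  qed
qed

end
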